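(* Let $d\ge1$ and $L^\infty=L^\infty(\mathbb{R}^d)$. The quotient space $L^\infty/(\mathcal{S}'_h\cap L^\infty)$ is not separable. In fact, there exists an embedding $J:\ell^\infty\to L^\infty$ which satisfies $J(c_0)\subset\mathcal{S}'_h\cap L^\infty$ and whose induced map between the (non-separable) quotient spaces $J':\ell^\infty/c_0\to L^\infty/(\mathcal{S}'_h\cap L^\infty)$ is a quasi-isometry.
   Context: Functions are complex-valued. Fix a smooth radial function $\chi:\mathbb{R}^d\to\mathbb{R}$ supported in the ball $B(0,2)$, equal to $1$ in a neighborhood of $B(0,1)$, and such that $r\mapsto\chi(re)$ is nonincreasing on $\mathbb{R}_+$ for every unit vector $e$. $\mathcal{S}'_h$ is the space of tempered distributions $f\in\mathcal{S}'(\mathbb{R}^d)$ such that $\chi(\lambda\xi)\widehat f(\xi)\to0$ in $\mathcal{S}'$ as $\lambda\to+\infty$. The intersection $\mathcal{S}'_h\cap L^\infty$ is a closed subspace of $L^\infty$ for the norm topology. $\ell^\infty=\ell^\infty(\mathbb{N})$ is the space of bounded sequences and $c_0\subset\ell^\infty$ the subspace of sequences converging to $0$. For a closed subspace $C$ of a Banach space $X$, $X/C$ carries the norm $\|x\|_{X/C}=\inf_{h\in C}\|x-h\|_X$. An embedding is an injective bounded linear map. A quasi-isometry (not required to be surjective) is a linear map $T$ between normed spaces for which there is a constant $K\ge1$ with $K^{-1}\|x\|\le\|Tx\|\le K\|x\|$ for all $x$. The induced map $J'$ sends the class of $u$ modulo $c_0$ to the class of $Ju$ modulo $\mathcal{S}'_h\cap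 L^\infty$. *)

theory Defs
  imports "HOL-Analysis.Analysis" "HOL-Probability.Essential_Supremum" "HOL-Library.Set_Algebras"
begin

section \<open>Complex normed spaces\<close>

class complex_normed_vector = real_normed_vector +
  fixes scaleC :: "complex \<Rightarrow> 'a \<Rightarrow> 'a"  (infixr \<open>*\<^sub>C\<close> 75)
  assumes scaleC_add_right: "a *\<^sub>C (x + y) = a *\<^sub>C x + a *\<^sub>C y"
    and scaleC_add_left: "(a + b) *\<^sub>C x = a *\<^sub>C x + b *\<^sub>C x"
    and scaleC_scaleC: "a *\<^sub>C b *\<^sub>C x = (a * b) *\<^sub>C x"
    and scaleC_of_real: "complex_of_real r *\<^sub>C x = r *\<^sub>R x"
    and norm_scaleC: "norm (a *\<^sub>C x) = cmod a * norm x"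

definition bounded_clinear :: "('a::complex_normed_vector \<Rightarrow> 'b::complex_normed_vector) \<Rightarrow> bool" where
  "bounded_clinear T \<longleftrightarrow> bounded_linear T \<and> (\<forall>a x. T (a *\<^sub>C x) = a *\<^sub>C T x)"

definition embedding :: "('a::complex_normed_vector \<Rightarrow> 'b::complex_normed_vector) \<Rightarrow> bool" where
  "embedding T \<longleftrightarrow> bounded_clinear T \<and> inj T"

instantiation complex :: complex_normed_vector
begin

definition scaleC_complex :: "complex \<Rightarrow> complex \<Rightarrow> complex" where
  "scaleC_complex a x = a * x"

instance
  by standard (auto simp: scaleC_complex_def algebra_simps norm_mult scaleR_conv_of_real)

end

text \<open>Since \<^typ>\<open>nat\<close> is discrete, \<^typ>\<open>nat \<Rightarrow>\<^sub>C complex\<close> is the space of all bounded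
  complex sequences, with the sup norm.\<close>

unbundle bcontfun.lifting

instantiation bcontfun :: (topological_space, complex_normed_vector) complex_normed_vector
begin

lift_definition scaleC_bcontfun :: "complex \<Rightarrow> ('a \<Rightarrow>\<^sub>C 'b) \<Rightarrow> ('a \<Rightarrow>\<^sub>C 'b)" is "\<lambda>a u x. a *\<^sub>C u x"
proof -
  fix a :: complex and u :: "'a \<Rightarrow> 'b"
  have 1: "bounded_linear (\<lambda>y::'b. a *\<^sub>C y)"
  proof (rule bounded_linear_intro)
    show "a *\<^sub>C (r *\<^sub>R x) = r *\<^sub>R (a *\<^sub>C x)" for r and x :: 'b
      by (simp add: scaleC_scaleC mult.commute flip: scaleC_of_real)
    show "norm (a *\<^sub>C x) \<le> norm x * cmod a" for x :: 'b
      by (simp add: norm_scaleC mult.commute)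
  qed (rule scaleC_add_right)
  assume "u \<in> bcontfun"
  then show "(\<lambda>x. a *\<^sub>C u x) \<in> bcontfun"
    using bounded_linear_image[OF _ 1, of "range u"] bounded_linear.continuous_on[OF 1]
    by (auto simp: bcontfun_def image_image)
qed

instance
proof
  fix a b :: complex and r :: real and x y :: "'a \<Rightarrow>\<^sub>C 'b"
  show "a *\<^sub>C (x + y) = a *\<^sub>C x + a *\<^sub>C y"
    by transfer (simp add: scaleC_add_right)
  show "(a + b) *\<^sub>C x = a *\<^sub>C x + b *\<^sub>C x"
    by transfer (simp add: scaleC_add_left)
  show "a *\<^sub>C b *\<^sub>C x = (a * b) *\<^sub>C x"
    by transfer (simp add: scaleC_scaleC)
  show *: "complex_of_real r *\<^sub>C x = r *\<^sub>R x" for r and x :: "'a \<Rightarrow>\<^sub>C 'b"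
    by transfer (simp add: scaleC_of_real)
  have le: "norm (c *\<^sub>C z) \<le> cmod c * norm z" for c and z :: "'a \<Rightarrow>\<^sub>C 'b"
    by (rule norm_bound) (simp add: scaleC_bcontfun.rep_eq norm_scaleC mult_left_mono norm_bounded)
  show "norm (a *\<^sub>C x) = cmod a * norm x"
  proof (cases "a = 0")
    case True
    then show ?thesis using le[of a x] by simp
  next
    case False
    have "x = inverse a *\<^sub>C a *\<^sub>C x"
      using False *[of 1 x] by transfer (simp add: scaleC_scaleC)
    then have "norm x \<le> cmod (inverse a) * norm (a *\<^sub>C x)"
      using le[of "inverse a" "a *\<^sub>C x"] by simp
    then have "cmod a * norm x \<le> norm (a *\<^sub>C x)"
      using False by (simp add: norm_inverse norm_divide field_simps)
    with le[of a x] show ?thesis by simp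
  qed
qed

end

lifting_forget bcontfun.lifting

definition c0 :: "(nat \<Rightarrow>\<^sub>C complex) set" where
  "c0 = {u. apply_bcontfun u \<longlonglongrightarrow> 0}"


section \<open>The space of essentially bounded functions\<close>

definition ess_bounded :: "(real^'n \<Rightarrow> complex) \<Rightarrow> bool" where
  "ess_bounded f \<longleftrightarrow> f \<in> borel_measurable lebesgue \<and> (\<exists>B::real. AE x in lebesgue. cmod (f x) \<le> B)"

definition ess_norm :: "(real^'n \<Rightarrow> complex) \<Rightarrow> real" where
  "ess_norm f = real_of_ereal (esssup lebesgue (\<lambda>x. ereal (cmod (f x))))"

lemma
  assumes "ess_bounded (f :: real^'n \<Rightarrow> complex)"
  shows ess_norm_nonneg: "0 \<le> ess_norm f"
    and ess_norm_AE: "AE x in lebesgue. cmod (f x) \<le> ess_norm f"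
    and ess_norm_le: "\<And>B. AE x in lebesgue. cmod (f x) \<le> B \<Longrightarrow> ess_norm f \<le> B"
proof -
  let ?s = "esssup lebesgue (\<lambda>x. ereal (cmod (f x)))"
  have [measurable]: "f \<in> borel_measurable lebesgue"
    using assms by (simp add: ess_bounded_def)
  have "emeasure lebesgue (UNIV :: (real^'n) set) \<noteq> 0"
    by simp
  then have "esssup lebesgue (\<lambda>x::real^'n. 0::ereal) = 0"
    by (intro esssup_const) simp
  moreover have "esssup lebesgue (\<lambda>x::real^'n. 0::ereal) \<le> ?s"
    by (rule esssup_mono) auto
  ultimately have 0: "0 \<le> ?s" by simp
  have le: "?s \<le> ereal B" if "AE x in lebesgue. cmod (f x) \<le> B" for B
    by (rule esssup_I) (use that in auto)
  obtain B0 where "?s \<le> ereal B0"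
    using assms le unfolding ess_bounded_def by blast
  with 0 obtain s where s: "?s = ereal s"
    by (cases ?s) auto
  show "0 \<le> ess_norm f"
    using 0 by (simp add: ess_norm_def s)
  show "AE x in lebesgue. cmod (f x) \<le> ess_norm f"
    using esssup_AE[of "\<lambda>x. ereal (cmod (f x))" lebesgue] by (simp add: ess_norm_def s)
  show "ess_norm f \<le> B" if "AE x in lebesgue. cmod (f x) \<le> B" for B
    using le[OF that] by (simp add: ess_norm_def s)
qed

lemma ess_bounded_add:
  assumes "ess_bounded f" "ess_bounded g"
  shows "ess_bounded (\<lambda>x. f x + g x)"
proof -
  have "AE x in lebesgue. cmod (f x + g x) \<le> ess_norm f + ess_norm g"
    using ess_norm_AE[OF assms(1)] ess_norm_AE[OF assms(2)]
    by eventually_elim (rule norm_triangle_le, simp)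
  then show ?thesis
    using assms unfolding ess_bounded_def by (blast intro: borel_measurable_add)
qed

lemma ess_bounded_cmult:
  assumes "ess_bounded f"
  shows "ess_bounded (\<lambda>x. a * f x)"
proof -
  have "AE x in lebesgue. cmod (a * f x) \<le> cmod a * ess_norm f"
    using ess_norm_AE[OF assms]
    by eventually_elim (simp add: norm_mult mult_left_mono)
  moreover have "(\<lambda>x. a * f x) \<in> borel_measurable lebesgue"
    using assms unfolding ess_bounded_def by (intro borel_measurable_times) auto
  ultimately show ?thesis
    unfolding ess_bounded_def by blast
qed

lemma ess_bounded_zero: "ess_bounded (\<lambda>x. 0)"
  by (auto simp: ess_bounded_def)

definition linfty_rel :: "(real^'n \<Rightarrow> complex) \<Rightarrow> (real^'n \<Rightarrow> complex) \<Rightarrow> bool" where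
  "linfty_rel f g \<longleftrightarrow> ess_bounded f \<and> ess_bounded g \<and> (AE x in lebesgue. f x = g x)"

lemma ess_norm_cong:
  assumes "linfty_rel f g"
  shows "ess_norm f = ess_norm g"
  using assms unfolding linfty_rel_def ess_bounded_def ess_norm_def
  by (intro arg_cong[of _ _ real_of_ereal] esssup_AE_cong) auto

quotient_type (overloaded) 'n linfty = "real^'n \<Rightarrow> complex" / partial: linfty_rel
proof (rule part_equivpI)
  show "\<exists>f. linfty_rel f f"
    by (rule exI[of _ "\<lambda>_. 0"]) (simp add: linfty_rel_def ess_bounded_zero)
  show "symp linfty_rel"
    by (auto simp: symp_def linfty_rel_def elim: AE_mp)
  show "transp linfty_rel"
    by (auto simp: transp_def linfty_rel_def)
qed

instantiation linfty :: (finite) complex_normed_vector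
begin

lift_definition zero_linfty :: "'a linfty" is "\<lambda>_. 0"
  by (simp add: linfty_rel_def ess_bounded_zero)

lift_definition plus_linfty :: "'a linfty \<Rightarrow> 'a linfty \<Rightarrow> 'a linfty" is "\<lambda>f g x. f x + g x"
  by (auto simp: linfty_rel_def ess_bounded_add)

lift_definition scaleC_linfty :: "complex \<Rightarrow> 'a linfty \<Rightarrow> 'a linfty" is "\<lambda>a f x. a * f x"
  by (auto simp: linfty_rel_def ess_bounded_cmult)

lift_definition norm_linfty :: "'a linfty \<Rightarrow> real" is ess_norm
  by (rule ess_norm_cong)

definition scaleR_linfty :: "real \<Rightarrow> 'a linfty \<Rightarrow> 'a linfty" where
  "scaleR_linfty r f = complex_of_real r *\<^sub>C f"

definition uminus_linfty :: "'a linfty \<Rightarrow> 'a linfty" where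
  "uminus_linfty f = (- 1) *\<^sub>C f"

definition minus_linfty :: "'a linfty \<Rightarrow> 'a linfty \<Rightarrow> 'a linfty" where
  "minus_linfty f g = f + (- g)"

definition sgn_linfty :: "'a linfty \<Rightarrow> 'a linfty" where
  "sgn_linfty f = inverse (norm f) *\<^sub>R f"

definition dist_linfty :: "'a linfty \<Rightarrow> 'a linfty \<Rightarrow> real" where
  "dist_linfty f g = norm (f - g)"

definition uniformity_linfty :: "('a linfty \<times> 'a linfty) filter" where
  "uniformity_linfty = (INF e\<in>{0<..}. principal {(f, g). dist f g < e})"

definition open_linfty :: "'a linfty set \<Rightarrow> bool" where
  "open_linfty U = (\<forall>f\<in>U. eventually (\<lambda>(f', g). f' = f \<longrightarrow> g \<in> U) uniformity)"

instance
proof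
  fix a b :: complex and r s :: real and f g h :: "'a linfty"
  note [simp] = linfty_rel_def ess_bounded_add ess_bounded_cmult ess_bounded_zero
  show add_assoc: "f + g + h = f + (g + h)"
    by transfer (simp add: algebra_simps)
  show "f + g = g + f"
    by transfer (simp add: algebra_simps)
  show "0 + f = f"
    by transfer simp
  show "- f + f = 0"
    unfolding uminus_linfty_def by transfer simp
  show "f - g = f + - g"
    by (simp add: minus_linfty_def)
  show right: "a *\<^sub>C (f + g) = a *\<^sub>C f + a *\<^sub>C g" for a and f g :: "'a linfty"
    by transfer (simp add: algebra_simps)
  show left: "(a + b) *\<^sub>C f = a *\<^sub>C f + b *\<^sub>C f" for a b and f :: "'a linfty"
    by transfer (simp add: algebra_simps)
  show assoc: "a *\<^sub>C b *\<^sub>C f = (a * b) *\<^sub>C f" for a b and f :: "'a linfty"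
    by transfer (simp add: algebra_simps)
  show "complex_of_real r *\<^sub>C f = r *\<^sub>R f"
    by (simp add: scaleR_linfty_def)
  show "r *\<^sub>R (f + g) = r *\<^sub>R f + r *\<^sub>R g" "(r + s) *\<^sub>R f = r *\<^sub>R f + s *\<^sub>R f"
    "r *\<^sub>R s *\<^sub>R f = (r * s) *\<^sub>R f"
    by (simp_all add: scaleR_linfty_def right left assoc)
  show "1 *\<^sub>R f = f"
    unfolding scaleR_linfty_def by transfer simp
  show "dist f g = norm (f - g)"
    by (simp add: dist_linfty_def)
  show "sgn f = inverse (norm f) *\<^sub>R f"
    by (simp add: sgn_linfty_def)
  show "(uniformity :: ('a linfty \<times> 'a linfty) filter) = (INF e\<in>{0<..}. principal {(f, g). dist f g < e})"
    by (simp add: uniformity_linfty_def)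
  show "open U \<longleftrightarrow> (\<forall>f\<in>U. eventually (\<lambda>(f', g). f' = f \<longrightarrow> g \<in> U) uniformity)" for U :: "'a linfty set"
    by (simp add: open_linfty_def)
  show "norm f = 0 \<longleftrightarrow> f = 0"
  proof transfer
    fix f :: "real^'a \<Rightarrow> complex"
    assume "linfty_rel f f"
    then have f: "ess_bounded f" by simp
    show "ess_norm f = 0 \<longleftrightarrow> linfty_rel f (\<lambda>_. 0)"
    proof
      assume "ess_norm f = 0"
      then show "linfty_rel f (\<lambda>_. 0)"
        using f ess_norm_AE[OF f] by simp
    next
      assume "linfty_rel f (\<lambda>_. 0)"
      then have "AE x in lebesgue. cmod (f x) \<le> 0" by simp
      from ess_norm_le[OF f this] ess_norm_nonneg[OF f] show "ess_norm f = 0" by simp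
    qed
  qed
  show "norm (f + g) \<le> norm f + norm g"
  proof transfer
    fix f g :: "real^'a \<Rightarrow> complex"
    assume "linfty_rel f f" "linfty_rel g g"
    then have f: "ess_bounded f" and g: "ess_bounded g" by simp_all
    have "AE x in lebesgue. cmod (f x + g x) \<le> ess_norm f + ess_norm g"
      using ess_norm_AE[OF f] ess_norm_AE[OF g]
      by eventually_elim (rule norm_triangle_le, simp)
    with f g show "ess_norm (\<lambda>x. f x + g x) \<le> ess_norm f + ess_norm g"
      by (intro ess_norm_le) simp_all
  qed
  show norm: "norm (a *\<^sub>C f) = cmod a * norm f" for a and f :: "'a linfty"
  proof transfer
    fix a and f :: "real^'a \<Rightarrow> complex"
    assume "linfty_rel f f"
    then have f: "ess_bounded f" by simp
    have le: "ess_norm (\<lambda>x. c * g x) \<le> cmod c * ess_norm g"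
      if g: "ess_bounded g" for c and g :: "real^'a \<Rightarrow> complex"
    proof (rule ess_norm_le)
      show "AE x in lebesgue. cmod (c * g x) \<le> cmod c * ess_norm g"
        using ess_norm_AE[OF g] by eventually_elim (simp add: norm_mult mult_left_mono)
    qed (simp add: g)
    show "ess_norm (\<lambda>x. a * f x) = cmod a * ess_norm f"
    proof (cases "a = 0")
      case True
      then show ?thesis
        using le[OF f, of a] ess_norm_nonneg[OF ess_bounded_cmult[OF f, of a]] by simp
    next
      case False
      have "ess_norm f \<le> cmod (inverse a) * ess_norm (\<lambda>x. a * f x)"
        using le[of "\<lambda>x. a * f x" "inverse a"] f False by (simp flip: mult.assoc)
      then have "cmod a * ess_norm f \<le> ess_norm (\<lambda>x. a * f x)"
        using False by (simp add: norm_inverse norm_divide field_simps)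
      with le[OF f, of a] show ?thesis by simp
    qed
  qed
  show "norm (r *\<^sub>R f) = \<bar>r\<bar> * norm f"
    by (simp add: scaleR_linfty_def norm)
qed

end


section \<open>Schwartz functions and tempered distributions\<close>

definition partial_deriv :: "'n \<Rightarrow> (real^'n \<Rightarrow> 'b::real_normed_vector) \<Rightarrow> real^'n \<Rightarrow> 'b" where
  "partial_deriv i f x = frechet_derivative f (at x) (axis i 1)"

definition partial_derivs :: "'n list \<Rightarrow> (real^'n \<Rightarrow> 'b::real_normed_vector) \<Rightarrow> real^'n \<Rightarrow> 'b" where
  "partial_derivs \<alpha> f = foldr partial_deriv \<alpha> f"

text \<open>Differentiability at every stage makes all the iterated Frechet derivatives genuine
  (and the iterated partial derivatives continuous).\<close>

definition smooth :: "(real^'n \<Rightarrow> 'b::real_normed_vector) \<Rightarrow> bool" where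
  "smooth f \<longleftrightarrow> (\<forall>\<alpha>. partial_derivs \<alpha> f differentiable_on UNIV)"

definition schwartz :: "(real^'n \<Rightarrow> complex) set" where
  "schwartz = {\<phi>. smooth \<phi> \<and>
     (\<forall>k \<alpha>. bounded (range (\<lambda>x. (1 + norm x) ^ k *\<^sub>R partial_derivs \<alpha> \<phi> x)))}"

definition schwartz_seminorm :: "nat \<Rightarrow> (real^'n \<Rightarrow> complex) \<Rightarrow> real" where
  "schwartz_seminorm N \<phi> =
     (\<Sum>\<alpha> | length \<alpha> \<le> N. SUP x. (1 + norm x) ^ N * cmod (partial_derivs \<alpha> \<phi> x))"

text \<open>A tempered distribution is represented by a functional on all functions of which only the
  values on \<^const>\<open>schwartz\<close> are meaningful; the seminorms above generate the usual topology of
  \<^const>\<open>schwartz\<close>, and they increase with \<open>N\<close>.\<close>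

definition tempered :: "((real^'n \<Rightarrow> complex) \<Rightarrow> complex) set" where
  "tempered = {T.
     (\<forall>\<phi>\<in>schwartz. \<forall>\<psi>\<in>schwartz. T (\<lambda>x. \<phi> x + \<psi> x) = T \<phi> + T \<psi>) \<and>
     (\<forall>a. \<forall>\<phi>\<in>schwartz. T (\<lambda>x. a * \<phi> x) = a * T \<phi>) \<and>
     (\<exists>B N. \<forall>\<phi>\<in>schwartz. cmod (T \<phi>) \<le> B * schwartz_seminorm N \<phi>)}"

definition fourier :: "(real^'n \<Rightarrow> complex) \<Rightarrow> real^'n \<Rightarrow> complex" where
  "fourier \<phi> \<xi> = (\<integral>x. exp (- \<i> * complex_of_real (x \<bullet> \<xi>)) * \<phi> x \<partial>lebesgue)"

definition fourier_dist :: "((real^'n \<Rightarrow> complex) \<Rightarrow> complex) \<Rightarrow> (real^'n \<Rightarrow> complex) \<Rightarrow> complex" where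
  "fourier_dist T \<phi> = T (fourier \<phi>)"

definition mult_dist :: "(real^'n \<Rightarrow> real) \<Rightarrow> ((real^'n \<Rightarrow> complex) \<Rightarrow> complex) \<Rightarrow> (real^'n \<Rightarrow> complex) \<Rightarrow> complex" where
  "mult_dist g T \<phi> = T (\<lambda>\<xi>. complex_of_real (g \<xi>) * \<phi> \<xi>)"

text \<open>Balls are closed here. For continuous \<open>\<eta>\<close>, vanishing outside the closed ball of radius 2
  is the same as vanishing outside the open one.\<close>

definition cutoff :: "(real^'n \<Rightarrow> real) \<Rightarrow> bool" where
  "cutoff \<eta> \<longleftrightarrow> smooth \<eta> \<and>
     (\<forall>x y. norm x = norm y \<longrightarrow> \<eta> x = \<eta> y) \<and>
     closure {x. \<eta> x \<noteq> 0} \<subseteq> cball 0 2 \<and>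
     (\<exists>U. open U \<and> cball 0 1 \<subseteq> U \<and> (\<forall>x\<in>U. \<eta> x = 1)) \<and>
     (\<forall>e. norm e = 1 \<longrightarrow> monotone_on {0..} (\<le>) (\<ge>) (\<lambda>r::real. \<eta> (r *\<^sub>R e)))"

definition Sh :: "(real^'n \<Rightarrow> real) \<Rightarrow> ((real^'n \<Rightarrow> complex) \<Rightarrow> complex) set" where
  "Sh \<eta> = {T \<in> tempered. \<forall>\<phi>\<in>schwartz.
     ((\<lambda>t::real. mult_dist (\<lambda>\<xi>. \<eta> (t *\<^sub>R \<xi>)) (fourier_dist T) \<phi>) \<longlongrightarrow> 0) at_top}"

lemma borel_measurable_lebesgue_AE_cong:
  fixes f g :: "real^'n \<Rightarrow> complex"
  assumes ae: "AE x in lebesgue. f x = g x" and f: "f \<in> borel_measurable lebesgue"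
  shows "g \<in> borel_measurable lebesgue"
proof (rule measurableI)
  fix A :: "complex set"
  assume "A \<in> sets borel"
  then have "f -` A \<inter> space lebesgue \<in> sets lebesgue"
    using f by (rule measurable_sets[rotated])
  moreover have "AE x in lebesgue. x \<in> f -` A \<inter> space lebesgue \<longleftrightarrow> x \<in> g -` A \<inter> space lebesgue"
    using ae by eventually_elim simp
  ultimately show "g -` A \<inter> space lebesgue \<in> sets lebesgue"
    by (intro completion.in_sets_AE[of "f -` A \<inter> space lebesgue" "g -` A \<inter> space lebesgue"]) auto
qed simp

lemma integral_lebesgue_AE_cong:
  fixes f g :: "real^'n \<Rightarrow> complex"
  assumes "AE x in lebesgue. f x = g x"
  shows "integral\<^sup>L lebesgue f = integral\<^sup>L lebesgue g"
proof (cases "f \<in> borel_measurable lebesgue")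
  case True
  then show ?thesis
    using assms borel_measurable_lebesgue_AE_cong by (blast intro: integral_cong_AE)
next
  case False
  have "AE x in lebesgue. g x = f x"
    using assms by eventually_elim simp
  then have "g \<notin> borel_measurable lebesgue"
    using False borel_measurable_lebesgue_AE_cong by blast
  with False show ?thesis
    by (metis not_integrable_integral_eq borel_measurable_integrable)
qed

lift_definition dist_of_linfty :: "'n linfty \<Rightarrow> (real^'n \<Rightarrow> complex) \<Rightarrow> complex" is
  "\<lambda>f \<phi>. \<integral>x. f x * \<phi> x \<partial>lebesgue"
  by (intro ext integral_lebesgue_AE_cong) (auto simp: linfty_rel_def)

definition Sh_linfty :: "(real^'n \<Rightarrow> real) \<Rightarrow> 'n linfty set" where
  "Sh_linfty \<eta> = {f. dist_of_linfty f \<in> Sh \<eta>}"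


section \<open>Quotients of normed spaces\<close>

text \<open>Cosets are added as sets; the summand \<open>C\<close> in \<open>quot_scale\<close> matters for \<open>a = 0\<close>. As \<open>C\<close> is a subspace, the infimum of \<open>norm (x - h)\<close> over
  \<open>h \<in> C\<close> is the infimum of the norm over the coset \<open>x +o C\<close>.\<close>

definition quot :: "'a::complex_normed_vector set \<Rightarrow> 'a set set" where
  "quot C = range (\<lambda>x. x +o C)"

definition quot_norm :: "'a::complex_normed_vector set \<Rightarrow> real" where
  "quot_norm X = (INF x\<in>X. norm x)"

definition quot_scale :: "'a::complex_normed_vector set \<Rightarrow> complex \<Rightarrow> 'a set \<Rightarrow> 'a set" where
  "quot_scale C a X = scaleC a ` X + C"

text \<open>The distance between the cosets of \<open>x\<close> and \<open>y\<close> is the quotient norm of the coset of \<open>x - y\<close>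
  (see \<open>setdist_coset\<close> below).\<close>

definition quot_topology :: "'a::complex_normed_vector set \<Rightarrow> 'a set topology" where
  "quot_topology C = Metric_space.mtopology (quot C) setdist"

definition quot_quasi_isometry ::
  "'a::complex_normed_vector set \<Rightarrow> 'b::complex_normed_vector set \<Rightarrow> ('a set \<Rightarrow> 'b set) \<Rightarrow> bool" where
  "quot_quasi_isometry C D T \<longleftrightarrow>
     T ` quot C \<subseteq> quot D \<and>
     (\<forall>X\<in>quot C. \<forall>Y\<in>quot C. T (X + Y) = T X + T Y) \<and>
     (\<forall>a. \<forall>X\<in>quot C. T (quot_scale C a X) = quot_scale D a (T X)) \<and>
     (\<exists>K\<ge>1. \<forall>X\<in>quot C. inverse K * quot_norm X \<le> quot_norm (T X) \<and> quot_norm (T X) \<le> K * quot_norm X)"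

definition induced_map :: "('a::complex_normed_vector \<Rightarrow> 'b::complex_normed_vector) \<Rightarrow> 'b set \<Rightarrow> 'a set \<Rightarrow> 'b set" where
  "induced_map J D X = J ` X + D"


lemma induced_map_coset:
  assumes "bounded_clinear J" "J ` C \<subseteq> D" "0 \<in> C" "\<And>x y. x \<in> D \<Longrightarrow> y \<in> D \<Longrightarrow> x + y \<in> D"
  shows "induced_map J D (u +o C) = J u +o D"
proof -
  interpret bounded_linear J
    using assms(1) by (simp add: bounded_clinear_def)
  show ?thesis
  proof (intro equalityI subsetI)
    fix y assume "y \<in> induced_map J D (u +o C)"
    then obtain c d where "c \<in> C" "d \<in> D" "y = J (u + c) + d"
      by (auto simp: induced_map_def set_plus_def elt_set_plus_def)
    then show "y \<in> J u +o D"
      using assms(2,4) by (auto simp: elt_set_plus_def add add.assoc)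
  next
    fix y assume "y \<in> J u +o D"
    then obtain d where "d \<in> D" "y = J (u + 0) + d"
      by (auto simp: elt_set_plus_def)
    then show "y \<in> induced_map J D (u +o C)"
      using assms(3) unfolding induced_map_def set_plus_def elt_set_plus_def by blast
  qed
qed


lemma quot_norm_coset:
  assumes "subspace C"
  shows "quot_norm (x +o C) = infdist x C"
proof -
  have "norm ` (x +o C) = dist x ` C"
  proof (intro equalityI subsetI)
    fix r assume "r \<in> norm ` (x +o C)"
    then obtain c where "c \<in> C" "r = norm (x + c)"
      by (auto simp: elt_set_plus_def)
    then show "r \<in> dist x ` C"
      using subspace_neg[OF assms, of c] by (intro image_eqI[of _ _ "- c"]) (auto simp: dist_norm)
  next
    fix r assume "r \<in> dist x ` C"
    then obtain c where "c \<in> C" "r = norm (x - c)"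
      by (auto simp: dist_norm)
    then show "r \<in> norm ` (x +o C)"
      using subspace_neg[OF assms, of c]
      by (intro image_eqI[of _ _ "x + - c"]) (auto simp: elt_set_plus_def)
  qed
  moreover have "C \<noteq> {}"
    using subspace_0[OF assms] by blast
  ultimately show ?thesis
    by (simp add: quot_norm_def infdist_notempty image_image)
qed

lemma setdist_coset:
  assumes "subspace C"
  shows "setdist (x +o C) (y +o C) = quot_norm ((x - y) +o C)"
proof -
  have 0: "0 \<in> C"
    using assms by (rule subspace_0)
  then have ne: "x +o C \<noteq> {}" "y +o C \<noteq> {}"
    by (auto simp: elt_set_plus_def)
  have "{dist a b |a b. a \<in> x +o C \<and> b \<in> y +o C} = norm ` ((x - y) +o C)"
  proof (intro equalityI subsetI)
    fix r assume "r \<in> {dist a b |a b. a \<in> x +o C \<and> b \<in> y +o C}"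
    then obtain a b where *: "a \<in> C" "b \<in> C" "r = norm (x + a - (y + b))"
      by (auto simp: elt_set_plus_def dist_norm)
    then have "a - b \<in> C"
      using assms by (intro subspace_diff)
    then have "x - y + (a - b) \<in> (x - y) +o C"
      unfolding elt_set_plus_def by blast
    moreover have "r = norm (x - y + (a - b))"
      using * by (simp add: algebra_simps)
    ultimately show "r \<in> norm ` ((x - y) +o C)"
      by blast
  next
    fix r assume "r \<in> norm ` ((x - y) +o C)"
    then obtain c where c: "c \<in> C" "r = norm (x - y + c)"
      by (auto simp: elt_set_plus_def)
    then have "r = dist (x + c) (y + 0)"
      by (simp add: dist_norm algebra_simps)
    with c(1) show "r \<in> {dist a b |a b. a \<in> x +o C \<and> b \<in> y +o C}"
      using 0 unfolding elt_set_plus_def by blast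
  qed
  then show ?thesis
    using ne by (simp add: setdist_def quot_norm_def)
qed

lemma Metric_space_quot:
  fixes C :: "'a::complex_normed_vector set"
  assumes C: "subspace C" "closed C"
  shows "Metric_space (quot C) setdist"
proof -
  have ne: "C \<noteq> {}"
    using subspace_0[OF C(1)] by blast
  have neg: "infdist (- x) C \<le> infdist x C" for x
    unfolding infdist_notempty[OF ne, of x]
  proof (rule cINF_greatest[OF ne])
    fix c assume "c \<in> C"
    then have "infdist (- x) C \<le> dist (- x) (- c)"
      using subspace_neg[OF C(1)] by (intro infdist_le) auto
    then show "infdist (- x) C \<le> dist x c"
      by (simp add: dist_minus)
  qed
  have tri: "infdist (x + y) C \<le> infdist x C + infdist y C" for x y
  proof -
    have "infdist (x + y) C - dist x c \<le> infdist y C" if c: "c \<in> C" for c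
      unfolding infdist_notempty[OF ne, of y]
    proof (rule cINF_greatest[OF ne])
      fix b assume "b \<in> C"
      then have "infdist (x + y) C \<le> dist (x + y) (c + b)"
        using c subspace_add[OF C(1)] by (intro infdist_le) auto
      also have "\<dots> \<le> dist x c + dist y b"
        by (rule dist_triangle_add)
      finally show "infdist (x + y) C - dist x c \<le> dist y b" by simp
    qed
    then have "infdist (x + y) C - infdist y C \<le> infdist x C"
      unfolding infdist_notempty[OF ne, of x] by (intro cINF_greatest[OF ne]) (simp add: algebra_simps)
    then show ?thesis by simp
  qed
  have eq: "x +o C = y +o C \<longleftrightarrow> infdist (x - y) C = 0" for x y
  proof -
    have "infdist (x - y) C = 0 \<longleftrightarrow> x - y \<in> C"
      using in_closed_iff_infdist_zero[OF C(2) ne] by simp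
    also have "\<dots> \<longleftrightarrow> x +o C = y +o C"
    proof
      assume *: "x - y \<in> C"
      have "x + c = y + ((x - y) + c)" "y + c = x + (c - (x - y))" for c
        by simp_all
      then show "x +o C = y +o C"
        using * subspace_add[OF C(1)] subspace_diff[OF C(1)]
        unfolding elt_set_plus_def by blast
    next
      assume "x +o C = y +o C"
      then have "x + 0 \<in> y +o C"
        using subspace_0[OF C(1)] by (auto simp: elt_set_plus_def)
      then show "x - y \<in> C"
        by (auto simp: elt_set_plus_def)
    qed
    finally show ?thesis by simp
  qed
  show ?thesis
  proof
    fix X Y Z :: "'a set"
    show "0 \<le> setdist X Y"
      by (rule setdist_pos_le)
    show "setdist X Y = setdist Y X"
      by (rule setdist_sym)
    assume "X \<in> quot C" "Y \<in> quot C" 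
    then obtain x y where [simp]: "X = x +o C" "Y = y +o C" 
      by (auto simp: quot_def)
    show "setdist X Y = 0 \<longleftrightarrow> X = Y"
      by (simp add: setdist_coset[OF C(1)] quot_norm_coset[OF C(1)] eq)
    assume "Z \<in> quot C"
    then obtain z where [simp]: "Z = z +o C"
      by (auto simp: quot_def)
    show "setdist X Z \<le> setdist X Y + setdist Y Z"
      using tri[of "x - y" "y - z"] by (simp add: setdist_coset[OF C(1)] quot_norm_coset[OF C(1)])
  qed
qed

end

theory Submission
  imports Defs "HOL-Probability.Sinc_Integral"
begin

text \<open>Write \<open>h\<close> for the Fourier transform of the cutoff \<open>\<eta>\<close>. Testing a bounded function \<open>f\<close> against a
  Schwartz function \<open>\<phi>\<close> and rescaling turns the defining condition of \<open>S'\<^sub>h\<close> into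
  \<open>\<integral> f(ty) K\<^sub>t(y) dy \<longlonglongrightarrow> 0\<close>, where \<open>K\<^sub>t\<close> is the Fourier transform of \<open>\<eta>(\<xi>) \<phi>(\<xi>/t)\<close>.
  The functions \<open>K\<^sub>t\<close> with \<open>t \<ge> 1\<close> have a common integrable majorant, hence bounded functions vanishing at
  infinity satisfy the condition; for \<open>\<phi> = \<eta>\<close> and \<open>t \<ge> 2\<close> one has \<open>K\<^sub>t = h\<close>.

  Let \<open>Ju\<close> be \<open>u\<^sub>n w(x/t\<^sub>n)\<close> on the \<open>n\<close>-th of a sequence of rapidly thickening shells with typical radius
  \<open>t\<^sub>n\<close>, where \<open>w\<close> has modulus 1 and \<open>wh = |h|\<close>. If \<open>u\<close> tends to 0, then so does \<open>Ju\<close> at infinity.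
  At scale \<open>t\<^sub>n\<close> the pairing of \<open>Ju\<close> with \<open>h\<close> is \<open>u\<^sub>n \<parallel>h\<parallel>\<^sub>1 + o(1)\<close>, while that of \<open>g \<in> S'\<^sub>h\<close> is \<open>o(1)\<close>; so
  \<open>\<parallel>Ju - g\<parallel> \<ge> limsup |u\<^sub>n|\<close>, and the induced map is even isometric. The factor \<open>w\<close> makes it
  enough that \<open>h\<close> is not 0, which is clear from \<open>h(0) = \<integral> \<eta>\<close>.\<close>

section \<open>Integration\<close>

lemma
  fixes f :: "'a::euclidean_space \<Rightarrow> 'b::{banach, second_countable_topology}"
  assumes c: "c \<noteq> 0"
  shows integral_lebesgue_scale: "f \<in> borel_measurable lebesgue \<Longrightarrow>
      integral\<^sup>L lebesgue f = \<bar>c\<bar> ^ DIM('a) *\<^sub>R (\<integral>x. f (c *\<^sub>R x) \<partial>lebesgue)"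
    and integrable_lebesgue_scale: "integrable lebesgue f \<Longrightarrow> integrable lebesgue (\<lambda>x. f (c *\<^sub>R x))"
proof -
  let ?D = "density (distr lebesgue lebesgue (\<lambda>x::'a. c *\<^sub>R x)) (\<lambda>_. ennreal (\<bar>c\<bar> ^ DIM('a)))"
  \<comment> \<open>\<open>lebesgue_affine_euclidean\<close> allows one factor per coordinate and a
    shift. With all factors equal to \<open>c\<close> and shift 0 its map is the dilation, and it
    presents \<open>lebesgue\<close> as a density over the image measure.\<close>
  have T: "(\<lambda>x::'a. 0 + (\<Sum>j\<in>Basis. (c * (x \<bullet> j)) *\<^sub>R j)) = (\<lambda>x. c *\<^sub>R x)"
    unfolding scaleR_scaleR[symmetric] scaleR_sum_right[symmetric] euclidean_representation by simp
  have eq: "lebesgue = ?D"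
    using lebesgue_affine_euclidean[of "\<lambda>_::'a. c" 0] c unfolding T by simp
  show "integral\<^sup>L lebesgue f = \<bar>c\<bar> ^ DIM('a) *\<^sub>R (\<integral>x. f (c *\<^sub>R x) \<partial>lebesgue)"
    if f: "f \<in> borel_measurable lebesgue"
  proof -
    have "integral\<^sup>L lebesgue f = integral\<^sup>L ?D f"
      using eq by metis
    also have "\<dots> = \<bar>c\<bar> ^ DIM('a) *\<^sub>R (\<integral>x. f (c *\<^sub>R x) \<partial>lebesgue)"
      using f lebesgue_measurable_scaling[of c] by (simp add: integral_density integral_distr)
    finally show ?thesis .
  qed
  show "integrable lebesgue (\<lambda>x. f (c *\<^sub>R x))" if f: "integrable lebesgue f"
  proof -
    have "integrable ?D f"
      using f eq by metis
    then have *: "integrable lebesgue (\<lambda>x. \<bar>c\<bar> ^ DIM('a) *\<^sub>R f (c *\<^sub>R x))"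
      using f lebesgue_measurable_scaling[of c] by (simp add: integrable_density integrable_distr_eq)
    have "integrable lebesgue (\<lambda>x. inverse (\<bar>c\<bar> ^ DIM('a)) *\<^sub>R \<bar>c\<bar> ^ DIM('a) *\<^sub>R f (c *\<^sub>R x))"
      by (rule integrable_scaleR_right) (rule *)
    moreover have "inverse (\<bar>c\<bar> ^ DIM('a)) *\<^sub>R \<bar>c\<bar> ^ DIM('a) *\<^sub>R v = v" for v :: 'b
      using c by simp
    ultimately show ?thesis
      by (simp only:)
  qed
qed

lemma integral_lebesgue_translate:
  fixes f :: "'a::euclidean_space \<Rightarrow> 'b::{banach, second_countable_topology}"
  assumes [measurable]: "f \<in> borel_measurable borel"
  shows "(\<integral>x. f (x + a) \<partial>lebesgue) = integral\<^sup>L lebesgue f"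
proof -
  have "integral\<^sup>L lborel f = integral\<^sup>L (distr lborel borel ((+) a)) f"
    by (simp add: lborel_distr_plus)
  also have "\<dots> = (\<integral>x. f (x + a) \<partial>lborel)"
    by (simp add: integral_distr add.commute)
  finally show ?thesis
    by (simp add: integral_completion)
qed

lemma integrable_lebesgue_compact_support:
  fixes f :: "'a::euclidean_space \<Rightarrow> 'b::{banach, second_countable_topology}"
  assumes f: "continuous_on UNIV f" and supp: "\<And>x. R < norm x \<Longrightarrow> f x = 0"
  shows "integrable lebesgue f"
proof -
  have "integrable lborel (\<lambda>x. indicator (cball 0 R) x *\<^sub>R f x)"
    by (intro borel_integrable_compact continuous_on_subset[OF f]) auto
  moreover have "(\<lambda>x. indicator (cball 0 R) x *\<^sub>R f x) = f"
    using supp by (auto simp: fun_eq_iff indicator_def not_le)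
  ultimately show ?thesis
    using f by (simp add: integrable_completion borel_measurable_continuous_onI)
qed

lemma bounded_compact_support:
  fixes f :: "'a::euclidean_space \<Rightarrow> 'b::real_normed_vector"
  assumes f: "continuous_on UNIV f" and supp: "\<And>x. R < norm x \<Longrightarrow> f x = 0"
  obtains B where "0 \<le> B" "\<And>x. norm (f x) \<le> B"
proof -
  have "compact (f ` cball 0 R)"
    by (intro compact_continuous_image continuous_on_subset[OF f]) auto
  then obtain B where B: "\<And>x. x \<in> cball 0 R \<Longrightarrow> norm (f x) \<le> B"
    by (meson bounded_iff compact_imp_bounded imageI)
  have "norm (f x) \<le> max 0 B" for x
  proof (cases "x \<in> cball 0 R")
    case True
    then show ?thesis using B by (simp add: max.coboundedI2)
  next
    case False
    then show ?thesis using supp[of x] by simp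
  qed
  then show ?thesis using that by (metis max.cobounded1)
qed

section \<open>An integrable weight and how to bound functions by it\<close>

lemma integrable_inverse_one_plus_square: "integrable lborel (\<lambda>x::real. inverse (1 + x\<^sup>2))"
  using integrable_inverse_1_plus_square by (simp add: set_integrable_def)

text \<open>The product form reduces integrability in any dimension to that of 1 / (1 + s^2) on the
  line, since Lebesgue measure is an image of a product measure. Multiples of \<open>weight\<close>
  serve as majorants of the kernels and of Schwartz functions.\<close>

definition weight :: "'a::euclidean_space \<Rightarrow> real" where
  "weight x = (\<Prod>b\<in>Basis. inverse (1 + (x \<bullet> b)\<^sup>2))"

lemma integrable_weight: "integrable lebesgue (weight :: 'a::euclidean_space \<Rightarrow> real)"
proof -
  interpret product_sigma_finite "\<lambda>_::'a. lborel :: real measure" ..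
  have [measurable]: "(weight :: 'a \<Rightarrow> real) \<in> borel_measurable borel"
    unfolding weight_def[abs_def] by measurable
  have "integrable (\<Pi>\<^sub>M b\<in>(Basis::'a set). lborel) (\<lambda>x. \<Prod>b\<in>Basis. inverse (1 + (x b :: real)\<^sup>2))"
    by (intro product_integrable_prod integrable_inverse_one_plus_square) auto
  also have "(\<lambda>x. \<Prod>b\<in>Basis. inverse (1 + (x b :: real)\<^sup>2)) = (\<lambda>x. weight (\<Sum>b\<in>(Basis::'a set). x b *\<^sub>R b))"
    by (simp add: weight_def inner_sum_left inner_Basis if_distrib cong: if_cong prod.cong)
  finally have "integrable lborel (weight :: 'a \<Rightarrow> real)"
    by (subst lborel_eq) (subst integrable_distr_eq, auto)
  then show ?thesis
    by (simp add: integrable_completion)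
qed

text \<open>Let \<open>m\<close> be the largest modulus of a coordinate of \<open>y\<close>. Every
  factor of 1 / \<open>weight y\<close> is at most 1 + m^2. For m <= 1 the bound on \<open>a\<close>
  itself suffices; for m > 1 one has 1 + m^2 <= 2 m^2, so decay in the direction attaining
  \<open>m\<close> is enough. Hence only powers of single coordinates have to be controlled, never
  mixed ones.\<close>

lemma le_weightI:
  fixes y :: "'a::euclidean_space"
  assumes A: "0 \<le> a" "a \<le> C" and C: "\<And>b. b \<in> Basis \<Longrightarrow> \<bar>y \<bullet> b\<bar> ^ (2 * DIM('a)) * a \<le> C"
  shows "a \<le> 2 ^ DIM('a) * C * weight y"
proof -
  define m where "m = Max ((\<lambda>b. \<bar>y \<bullet> b\<bar>) ` Basis)"
  have "m \<in> (\<lambda>b. \<bar>y \<bullet> b\<bar>) ` Basis"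
    unfolding m_def by (intro Max_in) auto
  then obtain b0 where b0: "b0 \<in> Basis" "m = \<bar>y \<bullet> b0\<bar>" by auto
  have m: "\<bar>y \<bullet> b\<bar> \<le> m" if "b \<in> Basis" for b
    unfolding m_def using that by (intro Max_ge) auto
  have le: "(\<Prod>b\<in>Basis. 1 + (y \<bullet> b)\<^sup>2) \<le> (1 + m\<^sup>2) ^ DIM('a)"
  proof -
    have "(y \<bullet> b)\<^sup>2 \<le> m\<^sup>2" if "b \<in> Basis" for b
      using power_mono[OF m[OF that], of 2] by simp
    then have "(\<Prod>b\<in>Basis. 1 + (y \<bullet> b)\<^sup>2) \<le> (\<Prod>b\<in>(Basis::'a set). 1 + m\<^sup>2)"
      by (intro prod_mono) (auto simp: add_nonneg_nonneg)
    then show ?thesis by simp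
  qed
  have "(1 + m\<^sup>2) ^ DIM('a) * a \<le> 2 ^ DIM('a) * C"
  proof (cases "m \<le> 1")
    case True
    then have "m\<^sup>2 \<le> 1" using b0 by (simp add: abs_square_le_1)
    then have "(1 + m\<^sup>2) ^ DIM('a) \<le> 2 ^ DIM('a)"
      by (intro power_mono) (auto simp: add_nonneg_nonneg)
    then show ?thesis using A by (intro mult_mono) auto
  next
    case False
    then have "1 \<le> m\<^sup>2" by (simp add: one_le_power)
    then have "(1 + m\<^sup>2) ^ DIM('a) \<le> (2 * m\<^sup>2) ^ DIM('a)"
      by (intro power_mono) (auto simp: add_nonneg_nonneg)
    also have "\<dots> = 2 ^ DIM('a) * m ^ (2 * DIM('a))"
      by (simp add: power_mult_distrib power_mult)
    finally have "(1 + m\<^sup>2) ^ DIM('a) * a \<le> 2 ^ DIM('a) * (m ^ (2 * DIM('a)) * a)"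
      using A(1) by (metis mult.assoc mult_right_mono)
    also have "\<dots> \<le> 2 ^ DIM('a) * C"
      using C[OF b0(1)] b0(2) by (intro mult_left_mono) auto
    finally show ?thesis .
  qed
  then have *: "(\<Prod>b\<in>Basis. 1 + (y \<bullet> b)\<^sup>2) * a \<le> 2 ^ DIM('a) * C"
    using le A(1) by (meson mult_right_mono order_trans)
  have pos: "0 < (\<Prod>b\<in>Basis. 1 + (y \<bullet> b)\<^sup>2)"
    by (intro prod_pos) (auto simp: add_pos_nonneg)
  have "weight y = inverse (\<Prod>b\<in>Basis. 1 + (y \<bullet> b)\<^sup>2)"
    by (simp add: weight_def prod_inversef[symmetric] o_def)
  then show ?thesis
    using * pos by (simp add: field_simps)
qed

section \<open>Integrals of directional derivatives\<close>

lemma directional_increment_bound: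
  fixes G :: "'a::real_normed_vector \<Rightarrow> 'b::real_normed_vector"
  assumes der: "\<And>x. (G has_derivative G' x) (at x)" and bnd: "\<And>x. norm (G' x e) \<le> B" and h: "0 \<le> h"
  shows "norm (G (x + h *\<^sub>R e) - G x) \<le> B * h"
proof -
  \<comment> \<open>The mean value inequality is applied to the restriction of \<open>G\<close> to a
    line, so only the derivative in direction \<open>e\<close> has to be bounded.\<close>
  have "norm ((\<lambda>s. G (x + s *\<^sub>R e)) h - (\<lambda>s. G (x + s *\<^sub>R e)) 0) \<le> B * norm (h - 0)"
  proof (rule differentiable_bound[of UNIV _ "\<lambda>s r. r *\<^sub>R G' (x + s *\<^sub>R e) e"])
    fix s :: real
    have "((\<lambda>s. G (x + s *\<^sub>R e)) has_derivative (\<lambda>r. G' (x + s *\<^sub>R e) (r *\<^sub>R e))) (at s)"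
      by (rule has_derivative_compose[OF _ der]) (auto intro!: derivative_eq_intros)
    then show "((\<lambda>s. G (x + s *\<^sub>R e)) has_derivative (\<lambda>r. r *\<^sub>R G' (x + s *\<^sub>R e) e)) (at s)"
      using has_derivative_bounded_linear[OF der] by (simp add: linear_simps)
    show "onorm (\<lambda>r. r *\<^sub>R G' (x + s *\<^sub>R e) e) \<le> B"
      using bnd by (intro onorm_le) (simp add: mult.commute[of B] mult_left_mono)
  qed auto
  then show ?thesis using h by simp
qed

text \<open>The integral of the difference quotients vanishes by translation invariance.\<close>

lemma integral_directional_derivative_eq_0:
  fixes G :: "'a::euclidean_space \<Rightarrow> 'b::{banach, second_countable_topology}"
  assumes der: "\<And>x. (G has_derivative G' x) (at x)" and bnd: "\<And>x. norm (G' x e) \<le> B"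
    and supp: "\<And>x. R < norm x \<Longrightarrow> G x = 0"
  shows "(\<integral>x. G' x e \<partial>lebesgue) = 0"
proof -
  have cont: "continuous_on UNIV G"
    using der by (intro has_derivative_continuous_on) auto
  then have [measurable]: "G \<in> borel_measurable borel"
    by (rule borel_measurable_continuous_onI)
  have int: "integrable lebesgue G"
    by (rule integrable_lebesgue_compact_support[OF cont supp])
  have supp': "norm (x + a) > R" if "norm x > R + norm a" for x a :: 'a
    using that norm_triangle_ineq4[of "x + a" a] by simp
  have int': "integrable lebesgue (\<lambda>x. G (x + a))" for a
    by (rule integrable_lebesgue_compact_support[where R="R + norm a"])
      (auto intro!: continuous_on_compose2[OF cont] continuous_intros supp supp')
  define s where "s n x = real (Suc n) *\<^sub>R (G (x + inverse (real (Suc n)) *\<^sub>R e) - G x)" for n x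
  have s0: "integral\<^sup>L lebesgue (s n) = 0" for n
    unfolding s_def using int int' by (simp add: integral_lebesgue_translate)
  have lim: "(\<lambda>n. s n x) \<longlonglongrightarrow> G' x e" for x
  proof -
    have "((\<lambda>s. G (x + s *\<^sub>R e)) has_derivative (\<lambda>r. G' (x + 0 *\<^sub>R e) (r *\<^sub>R e))) (at 0)"
      by (rule has_derivative_compose[OF _ der]) (auto intro!: derivative_eq_intros)
    then have "((\<lambda>s. G (x + s *\<^sub>R e)) has_derivative (\<lambda>r. r *\<^sub>R G' x e)) (at 0)"
      using has_derivative_bounded_linear[OF der] by (simp add: linear_simps)
    then have "((\<lambda>h. norm (G (x + h *\<^sub>R e) - G x - h *\<^sub>R G' x e) / norm h) \<longlongrightarrow> 0) (at 0)"
      by (simp add: has_derivative_at)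
    also have "?this \<longleftrightarrow> ((\<lambda>h. norm ((G (x + h *\<^sub>R e) - G x) /\<^sub>R h - G' x e)) \<longlongrightarrow> 0) (at 0)"
    proof (rule filterlim_cong[OF refl refl])
      show "\<forall>\<^sub>F h in at 0. norm (G (x + h *\<^sub>R e) - G x - h *\<^sub>R G' x e) / norm h
          = norm ((G (x + h *\<^sub>R e) - G x) /\<^sub>R h - G' x e)"
        unfolding eventually_at_filter
      proof (intro always_eventually allI impI)
        fix h :: real assume "h \<noteq> 0"
        then have "(G (x + h *\<^sub>R e) - G x) /\<^sub>R h - G' x e
            = (G (x + h *\<^sub>R e) - G x - h *\<^sub>R G' x e) /\<^sub>R h"
          by (simp add: scaleR_diff_right)
        then show "norm (G (x + h *\<^sub>R e) - G x - h *\<^sub>R G' x e) / norm h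
            = norm ((G (x + h *\<^sub>R e) - G x) /\<^sub>R h - G' x e)"
          by (simp add: divide_inverse mult.commute)
      qed
    qed
    finally have "((\<lambda>h. (G (x + h *\<^sub>R e) - G x) /\<^sub>R h) \<longlongrightarrow> G' x e) (at 0)"
      by (simp add: tendsto_norm_zero_iff LIM_zero_iff)
    moreover have "filterlim (\<lambda>n. inverse (real (Suc n))) (at 0) sequentially"
      by (intro filterlim_atI LIMSEQ_inverse_real_of_nat) auto
    ultimately have "(\<lambda>n. (G (x + inverse (real (Suc n)) *\<^sub>R e) - G x) /\<^sub>R inverse (real (Suc n))) \<longlonglongrightarrow> G' x e"
      by (rule filterlim_compose)
    then show ?thesis by (simp add: s_def)
  qed
  have [measurable]: "s n \<in> borel_measurable borel" for n
    unfolding s_def[abs_def] by measurable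
  \<comment> \<open>\<open>G'\<close> is merely some derivative; its measurability is obtained from
    the pointwise limit of the Borel functions \<open>s n\<close>.\<close>
  have [measurable]: "(\<lambda>x. G' x e) \<in> borel_measurable borel"
    by (rule borel_measurable_LIMSEQ_metric[OF _ lim]) auto
  have "(\<lambda>n. integral\<^sup>L lebesgue (s n)) \<longlonglongrightarrow> (\<integral>x. G' x e \<partial>lebesgue)"
  proof (rule integral_dominated_convergence)
    \<comment> \<open>The increments have length at most \<open>norm e\<close>, so all difference
      quotients vanish outside the ball of radius \<open>R + norm e\<close>; inside it the increment
      bound gives the constant \<open>B\<close>.\<close>
    show "integrable lebesgue (\<lambda>x. B * indicator (cball 0 (R + norm e)) x :: real)"
      by (intro integrable_mult_right integrable_real_indicator) (auto simp: emeasure_bounded_finite[unfolded infinity_ennreal_def])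
    show "AE x in lebesgue. norm (s n x) \<le> B * indicator (cball 0 (R + norm e)) x" for n
    proof (rule AE_I2)
      fix x :: 'a
      let ?h = "inverse (real (Suc n))"
      show "norm (s n x) \<le> B * indicator (cball 0 (R + norm e)) x"
      proof (cases "norm x \<le> R + norm e")
        case True
        have "norm (G (x + ?h *\<^sub>R e) - G x) \<le> B * ?h"
          by (rule directional_increment_bound[OF der bnd]) simp
        then have "norm (s n x) \<le> real (Suc n) * (B * ?h)"
          unfolding s_def norm_scaleR by (simp only: abs_of_nat mult_left_mono of_nat_0_le_iff)
        also have "real (Suc n) * (B * ?h) = B"
          by (simp add: field_simps del: of_nat_Suc)
        finally show ?thesis using True by simp
      next
        case False
        have "norm (?h *\<^sub>R e) \<le> 1 * norm e"
          unfolding norm_scaleR by (intro mult_right_mono) (auto simp: field_simps)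
        with False have "norm (x + ?h *\<^sub>R e) > R" "norm x > R"
          using supp'[of "?h *\<^sub>R e" x] norm_ge_zero[of e] by linarith+
        then show ?thesis using False by (simp add: s_def supp)
      qed
    qed
  qed (auto simp: lim measurable_completion)
  then show ?thesis
    by (simp add: s0 LIMSEQ_const_iff)
qed

section \<open>Fourier transforms of cut-off Schwartz functions\<close>

lemma continuous_on_fourier:
  fixes g :: "real^'n \<Rightarrow> complex"
  assumes g: "integrable lebesgue g"
  shows "continuous_on UNIV (fourier g)"
  unfolding continuous_on_sequentially
proof (intro allI impI ballI)
  fix X :: "nat \<Rightarrow> real^'n" and a :: "real^'n"
  assume "(\<forall>n. X n \<in> UNIV) \<and> X \<longlonglongrightarrow> a"
  then have X: "X \<longlonglongrightarrow> a" by simp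
  have [measurable]: "g \<in> borel_measurable lebesgue"
    using g by auto
  have [measurable]: "(\<lambda>x::real^'n. x \<bullet> b) \<in> borel_measurable lebesgue" for b
    by (rule measurable_completion) measurable
  have "(\<lambda>n. \<integral>x. exp (- \<i> * complex_of_real (x \<bullet> X n)) * g x \<partial>lebesgue)
      \<longlonglongrightarrow> (\<integral>x. exp (- \<i> * complex_of_real (x \<bullet> a)) * g x \<partial>lebesgue)"
  proof (rule integral_dominated_convergence)
    show "integrable lebesgue (\<lambda>x. norm (g x))"
      using g by simp
    show "AE x in lebesgue. (\<lambda>n. exp (- \<i> * complex_of_real (x \<bullet> X n)) * g x)
        \<longlonglongrightarrow> exp (- \<i> * complex_of_real (x \<bullet> a)) * g x"
      by (intro AE_I2 tendsto_intros X)
    show "AE x in lebesgue. norm (exp (- \<i> * complex_of_real (x \<bullet> X n)) * g x) \<le> norm (g x)" for n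
      by (simp add: norm_mult)
  qed measurable
  then show "(fourier g \<circ> X) \<longlonglongrightarrow> fourier g a"
    by (simp add: fourier_def o_def)
qed

lemma norm_fourier_le:
  assumes "integrable lebesgue g"
  shows "cmod (fourier g y) \<le> (\<integral>x. cmod (g x) \<partial>lebesgue)"
proof -
  have "cmod (fourier g y) \<le> (\<integral>x. cmod (exp (- \<i> * complex_of_real (x \<bullet> y)) * g x) \<partial>lebesgue)"
    unfolding fourier_def by (rule integral_norm_bound)
  then show ?thesis by (simp add: norm_mult)
qed

lemma fourier_add:
  fixes f g :: "real^'n \<Rightarrow> complex"
  assumes "integrable lebesgue f" "integrable lebesgue g"
  shows "fourier (\<lambda>x. f x + g x) y = fourier f y + fourier g y"
proof -
  have [measurable]: "(\<lambda>x::real^'n. x \<bullet> y) \<in> borel_measurable lebesgue"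
    by (rule measurable_completion) measurable
  have "integrable lebesgue (\<lambda>x. exp (- \<i> * complex_of_real (x \<bullet> y)) * f x)"
    if [measurable]: "integrable lebesgue f" for f :: "real^'n \<Rightarrow> complex"
    by (rule Bochner_Integration.integrable_bound[OF that]) (auto simp: norm_mult)
  then show ?thesis
    using assms by (simp add: fourier_def distrib_left)
qed

lemma fourier_cmult: "fourier (\<lambda>x. a * g x) y = a * fourier g y"
  by (simp add: fourier_def mult.left_commute)

lemma fourier_scale:
  fixes g :: "real^'n \<Rightarrow> complex"
  assumes g: "g \<in> borel_measurable lebesgue" and t: "0 < t"
  shows "fourier (\<lambda>\<xi>. g (t *\<^sub>R \<xi>)) x = inverse t ^ CARD('n) *\<^sub>R fourier g (inverse t *\<^sub>R x)"
proof -
  have [measurable]: "(\<lambda>x::real^'n. x \<bullet> b) \<in> borel_measurable lebesgue" for b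
    by (rule measurable_completion) measurable
  have "fourier g (inverse t *\<^sub>R x)
      = \<bar>t\<bar> ^ DIM(real^'n) *\<^sub>R (\<integral>\<xi>. exp (- \<i> * complex_of_real ((t *\<^sub>R \<xi>) \<bullet> (inverse t *\<^sub>R x))) * g (t *\<^sub>R \<xi>) \<partial>lebesgue)"
    unfolding fourier_def using g t by (intro integral_lebesgue_scale) auto
  also have "\<dots> = t ^ CARD('n) *\<^sub>R fourier (\<lambda>\<xi>. g (t *\<^sub>R \<xi>)) x"
  proof -
    have "(t *\<^sub>R \<xi>) \<bullet> (inverse t *\<^sub>R x) = \<xi> \<bullet> x" for \<xi>
      using t by simp
    then show ?thesis
      using t by (simp only: fourier_def abs_of_pos DIM_cart DIM_real mult_1_right)
  qed
  finally show ?thesis using t by (simp add: field_simps)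
qed

text \<open>Integration by parts: the directional derivative of the product of \<open>g\<close> with
  the exponential integrates to 0, and the product rule splits it into the two sides. Taking the
  derivative as a family \<open>g'\<close> instead of \<open>partial_deriv\<close> lets the caller
  supply the one produced by differentiation rules.\<close>

lemma fourier_partial_deriv:
  fixes g :: "real^'n \<Rightarrow> complex"
  assumes der: "\<And>x. (g has_derivative g' x) (at x)"
    and cont: "continuous_on UNIV (\<lambda>x. g' x (axis i 1))"
    and supp: "\<And>x. R < norm x \<Longrightarrow> g x = 0" and supp': "\<And>x. R < norm x \<Longrightarrow> g' x (axis i 1) = 0"
  shows "fourier (\<lambda>x. g' x (axis i 1)) y = \<i> * complex_of_real (y $ i) * fourier g y"
proof -
  define e :: "real^'n \<Rightarrow> complex" where "e x = exp (- \<i> * complex_of_real (x \<bullet> y))" for x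
  define G' where "G' x v = e x * g' x v + - \<i> * complex_of_real (v \<bullet> y) * e x * g x" for x v
  have cg: "continuous_on UNIV g"
    using der by (intro has_derivative_continuous_on) auto
  have ce: "continuous_on UNIV e"
    unfolding e_def by (intro continuous_intros)
  have e1: "cmod (e x) = 1" for x
    by (simp add: e_def)
  have derG: "((\<lambda>x. e x * g x) has_derivative G' x) (at x)" for x
  proof -
    have "((\<lambda>x. - \<i> * complex_of_real (x \<bullet> y)) has_derivative (\<lambda>v. - \<i> * complex_of_real (v \<bullet> y))) (at x)"
      by (auto intro!: derivative_eq_intros)
    from has_derivative_mult[OF has_derivative_compose[OF this
        has_field_derivative_imp_has_derivative[OF DERIV_exp]] der]
    show ?thesis
      unfolding e_def G'_def by (simp add: algebra_simps)
  qed
  have y: "axis i 1 \<bullet> y = y $ i"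
    by (simp add: inner_axis')
  obtain B1 where B1: "\<And>x. cmod (g x) \<le> B1"
    using bounded_compact_support[OF cg supp] by metis
  obtain B2 where B2: "\<And>x. cmod (g' x (axis i 1)) \<le> B2"
    using bounded_compact_support[OF cont supp'] by metis
  have "(\<integral>x. G' x (axis i 1) \<partial>lebesgue) = 0"
  proof (rule integral_directional_derivative_eq_0[OF derG, where R=R])
    show "norm (G' x (axis i 1)) \<le> B2 + \<bar>y $ i\<bar> * B1" for x
      unfolding G'_def y
      by (intro norm_triangle_mono) (auto simp: norm_mult e1 B2 intro!: mult_left_mono B1)
  qed (simp add: supp)
  moreover have "integrable lebesgue (\<lambda>x. e x * g' x (axis i 1))" "integrable lebesgue (\<lambda>x. e x * g x)"
    by (rule integrable_lebesgue_compact_support[where R=R];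
        auto intro!: continuous_intros ce cg cont simp: supp supp')+
  moreover have "G' x (axis i 1) = e x * g' x (axis i 1) - \<i> * complex_of_real (y $ i) * (e x * g x)" for x
    by (simp add: G'_def y)
  ultimately have "(\<integral>x. e x * g' x (axis i 1) \<partial>lebesgue)
      = \<i> * complex_of_real (y $ i) * (\<integral>x. e x * g x \<partial>lebesgue)"
    by simp
  then show ?thesis
    by (simp add: fourier_def e_def)
qed

section \<open>Iterated partial derivatives and Schwartz functions of compact support\<close>

lemma smooth_partial_derivs:
  assumes "smooth f"
  shows "partial_derivs \<alpha> f differentiable at x"
    and "(partial_derivs \<alpha> f has_derivative frechet_derivative (partial_derivs \<alpha> f) (at x)) (at x)"
    and "continuous_on UNIV (partial_derivs \<alpha> f)"
proof -
  have *: "partial_derivs \<alpha> f differentiable_on UNIV"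
    using assms by (simp add: smooth_def)
  then show 1: "partial_derivs \<alpha> f differentiable at x"
    by (simp add: differentiable_on_def)
  then show "(partial_derivs \<alpha> f has_derivative frechet_derivative (partial_derivs \<alpha> f) (at x)) (at x)"
    by (simp add: frechet_derivative_works)
  show "continuous_on UNIV (partial_derivs \<alpha> f)"
    using * by (rule differentiable_imp_continuous_on)
qed

lemma partial_derivs_Nil [simp]: "partial_derivs [] f = f"
  by (simp add: partial_derivs_def)

lemma partial_derivs_Cons:
  "partial_derivs (i # \<alpha>) f x = frechet_derivative (partial_derivs \<alpha> f) (at x) (axis i 1)"
  by (simp add: partial_derivs_def partial_deriv_def)

lemma partial_derivs_eq_0_outside:
  assumes "\<And>x. R < norm x \<Longrightarrow> f x = 0" and "R < norm x"
  shows "partial_derivs \<alpha> f x = 0"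
  using assms(2)
proof (induction \<alpha> arbitrary: x)
  case Nil
  then show ?case using assms(1) by simp
next
  case (Cons i \<alpha>)
  \<comment> \<open>Beyond radius \<open>R\<close> the function vanishes on a whole neighbourhood of
    the point, so its derivative there is 0 as well.\<close>
  have "open {x :: real^'n. R < norm x}"
    by (intro open_Collect_less continuous_intros)
  then have "(partial_derivs \<alpha> f has_derivative (\<lambda>_. 0)) (at x)"
    using Cons by (intro has_derivative_transform_within_open[OF has_derivative_const, of _ x]) auto
  then have "(\<lambda>_. 0) = frechet_derivative (partial_derivs \<alpha> f) (at x)"
    by (rule frechet_derivative_at)
  then show ?case
    by (metis partial_derivs_Cons)
qed

lemma partial_derivs_of_real:
  assumes "smooth f"
  shows "partial_derivs \<alpha> (\<lambda>x. complex_of_real (f x)) = (\<lambda>x. complex_of_real (partial_derivs \<alpha> f x))"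
proof (induction \<alpha>)
  case (Cons i \<alpha>)
  show ?case
  proof
    fix x
    have "((\<lambda>x. complex_of_real (partial_derivs \<alpha> f x)) has_derivative
        (\<lambda>v. complex_of_real (frechet_derivative (partial_derivs \<alpha> f) (at x) v))) (at x)"
      using smooth_partial_derivs(2)[OF assms] by (rule has_derivative_of_real)
    from frechet_derivative_at[OF this]
    show "partial_derivs (i # \<alpha>) (\<lambda>x. complex_of_real (f x)) x
        = complex_of_real (partial_derivs (i # \<alpha>) f x)"
      unfolding partial_derivs_Cons Cons by metis
  qed
qed simp

text \<open>Compact support turns every weighted derivative into a bounded continuous function. The
  lemma is meant for the cutoff itself, which later serves as a test function.\<close>

lemma of_real_in_schwartz:
  assumes f: "smooth f" and supp: "\<And>x. R < norm x \<Longrightarrow> f x = 0"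
  shows "(\<lambda>x. complex_of_real (f x)) \<in> schwartz"
proof -
  have "smooth (\<lambda>x. complex_of_real (f x))"
    unfolding smooth_def
  proof
    fix \<alpha>
    have "((\<lambda>x. complex_of_real (partial_derivs \<alpha> f x)) has_derivative
        (\<lambda>v. complex_of_real (frechet_derivative (partial_derivs \<alpha> f) (at x) v))) (at x)" for x
      using smooth_partial_derivs(2)[OF f] by (rule has_derivative_of_real)
    then show "partial_derivs \<alpha> (\<lambda>x. complex_of_real (f x)) differentiable_on UNIV"
      unfolding partial_derivs_of_real[OF f] differentiable_on_def differentiable_def by auto
  qed
  moreover have "bounded (range (\<lambda>x. (1 + norm x) ^ k *\<^sub>R complex_of_real (partial_derivs \<alpha> f x)))" for k \<alpha>
  proof (rule bounded_compact_support[where R=R and f="\<lambda>x. (1 + norm x) ^ k *\<^sub>R complex_of_real (partial_derivs \<alpha> f x)"])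
    show "continuous_on UNIV (\<lambda>x. (1 + norm x) ^ k *\<^sub>R complex_of_real (partial_derivs \<alpha> f x))"
      by (intro continuous_intros smooth_partial_derivs f)
    show "(1 + norm x) ^ k *\<^sub>R complex_of_real (partial_derivs \<alpha> f x) = 0" if "R < norm x" for x
      using partial_derivs_eq_0_outside[OF supp that] by simp
  qed (auto simp: bounded_iff)
  ultimately show ?thesis
    by (simp add: schwartz_def partial_derivs_of_real[OF f])
qed

text \<open>Induction on \<open>m\<close>: a factor \<open>y $ i\<close> is traded for a derivative
  in direction \<open>i\<close>, which falls either on \<open>\<eta>\<close> or on the dilated
  \<open>\<phi>\<close>; this is why \<open>\<alpha>\<close> and \<open>\<beta>\<close> must vary in
  the induction. The base case uses the supremum of a derivative of \<open>\<phi>\<close> and the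
  L^1 norm of a derivative of \<open>\<eta>\<close>. The point is that \<open>C\<close> is uniform
  in \<open>t\<close>.\<close>

lemma fourier_cutoff_bound:
  fixes \<eta> :: "real^'n \<Rightarrow> real"
  assumes \<eta>: "smooth \<eta>" and supp: "\<And>x. R < norm x \<Longrightarrow> \<eta> x = 0" and \<phi>: "\<phi> \<in> schwartz"
  shows "\<exists>C. \<forall>t\<ge>1. \<forall>y. \<bar>y $ i\<bar> ^ m *
    cmod (fourier (\<lambda>\<xi>. complex_of_real (partial_derivs \<alpha> \<eta> \<xi>) * partial_derivs \<beta> \<phi> (inverse t *\<^sub>R \<xi>)) y) \<le> C"
proof (induction m arbitrary: \<alpha> \<beta>)
  have s\<phi>: "smooth \<phi>"
    using \<phi> by (simp add: schwartz_def)
  let ?P = "\<lambda>\<alpha> \<beta> t \<xi>. complex_of_real (partial_derivs \<alpha> \<eta> \<xi>) * partial_derivs \<beta> \<phi> (inverse t *\<^sub>R \<xi>)"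
  have cont: "continuous_on UNIV (?P \<alpha> \<beta> t)" for \<alpha> \<beta> t
    by (intro continuous_intros smooth_partial_derivs \<eta>
        continuous_on_compose2[OF smooth_partial_derivs(3)[OF s\<phi>]]) auto
  have zero: "?P \<alpha> \<beta> t x = 0" if "R < norm x" for \<alpha> \<beta> t x
    using partial_derivs_eq_0_outside[OF supp that] by simp
  have int: "integrable lebesgue (?P \<alpha> \<beta> t)" for \<alpha> \<beta> t
    by (rule integrable_lebesgue_compact_support[OF cont zero])
  {
    case 0
    have "bounded (range (\<lambda>x. (1 + norm x) ^ 0 *\<^sub>R partial_derivs \<beta> \<phi> x))"
      using \<phi> unfolding schwartz_def by blast
    then obtain B where B: "\<And>x. cmod (partial_derivs \<beta> \<phi> x) \<le> B"
      by (auto simp: bounded_iff)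
    have int\<eta>: "integrable lebesgue (partial_derivs \<alpha> \<eta>)"
      by (rule integrable_lebesgue_compact_support[OF smooth_partial_derivs(3)[OF \<eta>]
            partial_derivs_eq_0_outside[OF supp]])
    have "cmod (fourier (?P \<alpha> \<beta> t) y) \<le> (\<integral>x. \<bar>partial_derivs \<alpha> \<eta> x\<bar> * B \<partial>lebesgue)" for t y
    proof -
      have "cmod (fourier (?P \<alpha> \<beta> t) y) \<le> (\<integral>x. cmod (?P \<alpha> \<beta> t x) \<partial>lebesgue)"
        by (rule norm_fourier_le[OF int])
      also have "\<dots> \<le> (\<integral>x. \<bar>partial_derivs \<alpha> \<eta> x\<bar> * B \<partial>lebesgue)"
        using int int\<eta> B by (intro integral_mono integrable_norm integrable_mult_left integrable_abs)
          (auto simp: norm_mult intro!: mult_left_mono)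
      finally show ?thesis .
    qed
    then show ?case by auto
  next
    case (Suc m)
    obtain C1 where C1: "\<And>t y. t \<ge> 1 \<Longrightarrow> \<bar>y $ i\<bar> ^ m * cmod (fourier (?P (i # \<alpha>) \<beta> t) y) \<le> C1"
      using Suc by blast
    obtain C2 where C2: "\<And>t y. t \<ge> 1 \<Longrightarrow> \<bar>y $ i\<bar> ^ m * cmod (fourier (?P \<alpha> (i # \<beta>) t) y) \<le> C2"
      using Suc by blast
    have "\<bar>y $ i\<bar> ^ Suc m * cmod (fourier (?P \<alpha> \<beta> t) y) \<le> C1 + C2" if t: "t \<ge> 1" for t y
    proof -
      define P' where "P' x v = complex_of_real (partial_derivs \<alpha> \<eta> x) *
            frechet_derivative (partial_derivs \<beta> \<phi>) (at (inverse t *\<^sub>R x)) (inverse t *\<^sub>R v)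
          + complex_of_real (frechet_derivative (partial_derivs \<alpha> \<eta>) (at x) v) * partial_derivs \<beta> \<phi> (inverse t *\<^sub>R x)" for x v
      have der: "(?P \<alpha> \<beta> t has_derivative P' x) (at x)" for x
        unfolding P'_def
        by (intro has_derivative_mult has_derivative_of_real smooth_partial_derivs \<eta>
            has_derivative_compose[OF _ smooth_partial_derivs(2)[OF s\<phi>]]) (auto intro!: derivative_eq_intros)
      have P': "P' x (axis i 1) = ?P (i # \<alpha>) \<beta> t x + complex_of_real (inverse t) * ?P \<alpha> (i # \<beta>) t x" for x
        unfolding P'_def partial_derivs_Cons linear_scale[OF linear_frechet_derivative[OF smooth_partial_derivs(1)[OF s\<phi>]]]
        by (simp add: scaleR_conv_of_real[where 'a=complex])
      have "\<i> * complex_of_real (y $ i) * fourier (?P \<alpha> \<beta> t) y = fourier (\<lambda>x. P' x (axis i 1)) y"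
      proof (rule fourier_partial_deriv[symmetric, OF der])
        show "continuous_on UNIV (\<lambda>x. P' x (axis i 1))"
          unfolding P' by (intro continuous_on_add continuous_on_mult continuous_on_const cont)
        show "P' x (axis i 1) = 0" if "R < norm x" for x
          unfolding P' zero[OF that] by simp
      qed (rule zero)
      also have "\<dots> = fourier (?P (i # \<alpha>) \<beta> t) y + complex_of_real (inverse t) * fourier (?P \<alpha> (i # \<beta>) t) y"
        unfolding P' by (subst fourier_add) (auto simp only: fourier_cmult int intro!: integrable_mult_right)
      finally have eq: "\<i> * complex_of_real (y $ i) * fourier (?P \<alpha> \<beta> t) y = \<dots>" .
      have "\<bar>y $ i\<bar> * cmod (fourier (?P \<alpha> \<beta> t) y) = cmod (\<i> * complex_of_real (y $ i) * fourier (?P \<alpha> \<beta> t) y)"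
        by (simp add: norm_mult)
      also have "\<dots> \<le> cmod (fourier (?P (i # \<alpha>) \<beta> t) y) + cmod (complex_of_real (inverse t) * fourier (?P \<alpha> (i # \<beta>) t) y)"
        unfolding eq by (rule norm_triangle_ineq)
      \<comment> \<open>The chain rule contributed the factor \<open>inverse t\<close>, which is at
        most 1, so the constant does not grow with the scale.\<close>
      also have "cmod (complex_of_real (inverse t) * fourier (?P \<alpha> (i # \<beta>) t) y) \<le> 1 * cmod (fourier (?P \<alpha> (i # \<beta>) t) y)"
        unfolding norm_mult norm_of_real using t by (intro mult_right_mono) (auto simp: field_simps)
      finally have "\<bar>y $ i\<bar> ^ m * (\<bar>y $ i\<bar> * cmod (fourier (?P \<alpha> \<beta> t) y))
          \<le> \<bar>y $ i\<bar> ^ m * (cmod (fourier (?P (i # \<alpha>) \<beta> t) y) + 1 * cmod (fourier (?P \<alpha> (i # \<beta>) t) y))"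
        by (intro mult_left_mono) auto
      also have "\<dots> \<le> C1 + C2"
        using C1[OF t, of y] C2[OF t, of y] by (simp add: distrib_left)
      finally show ?thesis by (simp add: mult.assoc mult.left_commute)
    qed
    then show ?case by blast
  }
qed

text \<open>The exponents 0 and 2 d, with d the dimension, are what \<open>le_weightI\<close> asks
  for; one constant serves all coordinates because there are finitely many.\<close>

lemma fourier_cutoff_le_weight:
  fixes \<eta> :: "real^'n \<Rightarrow> real"
  assumes \<eta>: "smooth \<eta>" and supp: "\<And>x. R < norm x \<Longrightarrow> \<eta> x = 0" and \<phi>: "\<phi> \<in> schwartz"
  obtains C where
    "\<And>t y. t \<ge> 1 \<Longrightarrow> cmod (fourier (\<lambda>\<xi>. complex_of_real (\<eta> \<xi>) * \<phi> (inverse t *\<^sub>R \<xi>)) y) \<le> C * weight y"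
proof -
  note * = fourier_cutoff_bound[OF \<eta> supp \<phi>, where R=R and \<alpha>="[]" and \<beta>="[]", unfolded partial_derivs_Nil]
  let ?F = "\<lambda>t. fourier (\<lambda>\<xi>. complex_of_real (\<eta> \<xi>) * \<phi> (inverse t *\<^sub>R \<xi>))"
  obtain C0 where C0: "\<And>t y. t \<ge> 1 \<Longrightarrow> cmod (?F t y) \<le> C0"
    using *[where m=0] by auto
  obtain C1 where C1: "\<And>i t y. t \<ge> 1 \<Longrightarrow> \<bar>y $ i\<bar> ^ (2 * CARD('n)) * cmod (?F t y) \<le> C1 i"
    using *[where m="2 * CARD('n)"] by metis
  define C where "C = Max (insert C0 (range C1))"
  have C: "C0 \<le> C" "C1 i \<le> C" for i
    unfolding C_def by (intro Max_ge; simp)+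
  have "cmod (?F t y) \<le> 2 ^ DIM(real^'n) * C * weight y" if t: "t \<ge> 1" for t y
  proof (rule le_weightI)
    fix b :: "real^'n" assume "b \<in> Basis"
    then obtain i where "b = axis i 1" by (auto simp: Basis_vec_def)
    then have "y \<bullet> b = y $ i" by (simp add: inner_axis)
    then show "\<bar>y \<bullet> b\<bar> ^ (2 * DIM(real^'n)) * cmod (?F t y) \<le> C"
      using C1[OF t, of y i] C(2)[of i] by simp
  qed (use C0[OF t, of y] C(1) in auto)
  then show ?thesis using that by blast
qed

section \<open>Pairing bounded functions with kernels\<close>

lemma linfty_cases:
  fixes f :: "'n::finite linfty"
  obtains f0 where "ess_bounded f0" "f = abs_linfty f0"
proof
  show "ess_bounded (rep_linfty f)"
    using Quotient_rep_reflp[OF Quotient_linfty, of f] by (simp add: linfty_rel_def)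
  show "f = abs_linfty (rep_linfty f)"
    by (rule Quotient_abs_rep[OF Quotient_linfty, symmetric])
qed

lemma linfty_rel_refl: "ess_bounded f \<Longrightarrow> linfty_rel f f"
  by (simp add: linfty_rel_def)

lemma dist_of_linfty_abs:
  "ess_bounded f \<Longrightarrow> dist_of_linfty (abs_linfty f) \<psi> = (\<integral>x. f x * \<psi> x \<partial>lebesgue)"
  by (simp add: dist_of_linfty.abs_eq linfty_rel_refl)

lemma norm_abs_linfty: "ess_bounded f \<Longrightarrow> norm (abs_linfty f) = ess_norm f"
  by (simp add: norm_linfty.abs_eq linfty_rel_refl)

lemma
  fixes f :: "real^'n \<Rightarrow> complex"
  assumes f: "ess_bounded f" and \<psi>: "integrable lebesgue \<psi>"
  shows ess_bounded_integrable: "integrable lebesgue (\<lambda>x. f x * \<psi> x)"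
    and ess_bounded_integral_le: "cmod (\<integral>x. f x * \<psi> x \<partial>lebesgue) \<le> ess_norm f * (\<integral>x. cmod (\<psi> x) \<partial>lebesgue)"
proof -
  have [measurable]: "f \<in> borel_measurable lebesgue" "\<psi> \<in> borel_measurable lebesgue"
    using f \<psi> by (auto simp: ess_bounded_def)
  have ae: "AE x in lebesgue. cmod (f x * \<psi> x) \<le> ess_norm f * cmod (\<psi> x)"
    using ess_norm_AE[OF f] by eventually_elim (simp add: norm_mult mult_right_mono)
  show int: "integrable lebesgue (\<lambda>x. f x * \<psi> x)"
  proof (rule Bochner_Integration.integrable_bound)
    show "integrable lebesgue (\<lambda>x. ess_norm f * cmod (\<psi> x))"
      using \<psi> by simp
    show "AE x in lebesgue. norm (f x * \<psi> x) \<le> norm (ess_norm f * cmod (\<psi> x))"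
      using ae by eventually_elim simp
  qed measurable
  have "cmod (\<integral>x. f x * \<psi> x \<partial>lebesgue) \<le> (\<integral>x. cmod (f x * \<psi> x) \<partial>lebesgue)"
    by (rule integral_norm_bound)
  also have "\<dots> \<le> (\<integral>x. ess_norm f * cmod (\<psi> x) \<partial>lebesgue)"
    using int \<psi> ae by (intro integral_mono_AE) auto
  finally show "cmod (\<integral>x. f x * \<psi> x \<partial>lebesgue) \<le> ess_norm f * (\<integral>x. cmod (\<psi> x) \<partial>lebesgue)"
    by simp
qed

lemma dist_of_linfty_le:
  assumes "integrable lebesgue \<psi>"
  shows "cmod (dist_of_linfty f \<psi>) \<le> norm f * (\<integral>x. cmod (\<psi> x) \<partial>lebesgue)"
proof -
  obtain f0 where "ess_bounded f0" "f = abs_linfty f0"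
    by (rule linfty_cases)
  then show ?thesis
    using ess_bounded_integral_le assms by (simp add: dist_of_linfty_abs norm_abs_linfty)
qed

lemma dist_of_linfty_add:
  assumes "integrable lebesgue \<psi>"
  shows "dist_of_linfty (f + g) \<psi> = dist_of_linfty f \<psi> + dist_of_linfty g \<psi>"
proof -
  obtain f0 where "ess_bounded f0" "f = abs_linfty f0"
    by (rule linfty_cases)
  moreover obtain g0 where "ess_bounded g0" "g = abs_linfty g0"
    by (rule linfty_cases)
  ultimately show ?thesis
    using assms by (simp add: plus_linfty.abs_eq linfty_rel_refl dist_of_linfty_abs ess_bounded_add
        distrib_right ess_bounded_integrable)
qed

lemma dist_of_linfty_scaleC: "dist_of_linfty (a *\<^sub>C f) \<psi> = a * dist_of_linfty f \<psi>"
proof -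
  obtain f0 where "ess_bounded f0" "f = abs_linfty f0"
    by (rule linfty_cases)
  then show ?thesis
    by (simp add: scaleC_linfty.abs_eq linfty_rel_refl dist_of_linfty_abs ess_bounded_cmult mult.assoc)
qed

lemma scaleC_zero [simp]: "0 *\<^sub>C x = (0 :: 'a::complex_normed_vector)"
  using scaleC_of_real[of 0 x] by simp

lemma scaleC_minus_one: "(- 1) *\<^sub>C x = - (x :: 'a::complex_normed_vector)"
  using scaleC_of_real[of "- 1" x] by simp

lemma dist_of_linfty_diff:
  assumes "integrable lebesgue \<psi>"
  shows "dist_of_linfty (f - g) \<psi> = dist_of_linfty f \<psi> - dist_of_linfty g \<psi>"
  using dist_of_linfty_add[OF assms, of f "- g"] dist_of_linfty_scaleC[of "- 1" g \<psi>]
  by (simp add: scaleC_minus_one)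

text \<open>The summand of \<open>schwartz_seminorm\<close> for the empty list of derivatives
  already controls \<open>(1 + norm x) ^ N * cmod (\<phi> x)\<close>; with N twice the dimension
  this is the decay required by \<open>le_weightI\<close>. Keeping the seminorm explicit in the
  bound is what makes bounded functions tempered distributions.\<close>

lemma
  fixes \<phi> :: "real^'n \<Rightarrow> complex"
  assumes \<phi>: "\<phi> \<in> schwartz"
  shows schwartz_le_seminorm: "cmod (\<phi> x) \<le> 2 ^ CARD('n) * schwartz_seminorm (2 * CARD('n)) \<phi> * weight x"
    and integrable_schwartz: "integrable lebesgue \<phi>"
proof -
  let ?N = "2 * CARD('n)"
  let ?S = "\<lambda>\<alpha>. SUP x. (1 + norm x) ^ ?N * cmod (partial_derivs \<alpha> \<phi> x)"
  have bdd: "bdd_above (range (\<lambda>x. (1 + norm x) ^ ?N * cmod (partial_derivs \<alpha> \<phi> x)))" for \<alpha>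
  proof -
    have "bounded (range (\<lambda>x. (1 + norm x) ^ ?N *\<^sub>R partial_derivs \<alpha> \<phi> x))"
      using \<phi> unfolding schwartz_def by blast
    then obtain B where "\<And>x. norm ((1 + norm x) ^ ?N *\<^sub>R partial_derivs \<alpha> \<phi> x) \<le> B"
      by (auto simp: bounded_iff)
    then show ?thesis
      by (intro bdd_aboveI2[of _ _ B]) simp
  qed
  have "finite {\<alpha> :: 'n list. length \<alpha> \<le> ?N}"
    using finite_lists_length_le[of "UNIV :: 'n set" ?N] by simp
  \<comment> \<open>Each supremum is at least its value at 0; nonnegativity allows the other
    summands of the seminorm to be dropped.\<close>
  moreover have "0 \<le> ?S \<alpha>" for \<alpha>
    by (rule cSUP_upper2[OF bdd UNIV_I[of 0]]) simp
  ultimately have S: "?S [] \<le> schwartz_seminorm ?N \<phi>"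
    unfolding schwartz_seminorm_def by (intro member_le_sum) auto
  have le: "(1 + norm x) ^ ?N * cmod (\<phi> x) \<le> schwartz_seminorm ?N \<phi>" for x
    using cSUP_upper[OF UNIV_I bdd[of "[]"], of x] S by simp
  show bound: "cmod (\<phi> x) \<le> 2 ^ CARD('n) * schwartz_seminorm ?N \<phi> * weight x" for x
  proof -
    have "cmod (\<phi> x) \<le> 2 ^ DIM(real^'n) * schwartz_seminorm ?N \<phi> * weight x"
    proof (rule le_weightI)
      have "1 * cmod (\<phi> x) \<le> (1 + norm x) ^ ?N * cmod (\<phi> x)"
        by (intro mult_right_mono one_le_power) auto
      then show "cmod (\<phi> x) \<le> schwartz_seminorm ?N \<phi>"
        using le[of x] by simp
      fix b :: "real^'n" assume "b \<in> Basis"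
      then have "\<bar>x \<bullet> b\<bar> \<le> 1 + norm x"
        using Basis_le_norm[of b x] by simp
      then have "\<bar>x \<bullet> b\<bar> ^ ?N * cmod (\<phi> x) \<le> (1 + norm x) ^ ?N * cmod (\<phi> x)"
        by (intro mult_right_mono power_mono) auto
      then show "\<bar>x \<bullet> b\<bar> ^ (2 * DIM(real^'n)) * cmod (\<phi> x) \<le> schwartz_seminorm ?N \<phi>"
        using le[of x] by simp
    qed simp
    then show ?thesis by simp
  qed
  have "continuous_on UNIV \<phi>"
    using smooth_partial_derivs(3)[of \<phi> "[]"] \<phi> by (simp add: schwartz_def)
  then have "\<phi> \<in> borel_measurable lebesgue"
    by (intro measurable_completion) (simp add: borel_measurable_continuous_onI)
  moreover have "norm (\<phi> x) \<le> norm (2 ^ CARD('n) * schwartz_seminorm ?N \<phi> * weight x)" for x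
    using bound[of x] by simp
  ultimately show "integrable lebesgue \<phi>"
    using integrable_mult_right[OF integrable_weight, of "2 ^ CARD('n) * schwartz_seminorm ?N \<phi>"]
    by (intro Bochner_Integration.integrable_bound[where g=\<phi>] AE_I2)
qed

text \<open>The L^1 norm of a test function is at most a multiple of a seminorm times the integral
  of \<open>weight\<close>. Temperedness thus holds for every bounded function, and membership in
  \<open>Sh_linfty\<close> reduces to the limit condition.\<close>

lemma dist_of_linfty_tempered: "dist_of_linfty (f :: 'n::finite linfty) \<in> tempered"
proof -
  obtain f0 where f0: "ess_bounded f0" "f = abs_linfty f0"
    by (rule linfty_cases)
  have "dist_of_linfty f (\<lambda>x. \<phi> x + \<psi> x) = dist_of_linfty f \<phi> + dist_of_linfty f \<psi>"
    if "\<phi> \<in> schwartz" "\<psi> \<in> schwartz" for \<phi> \<psi>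
    using that f0 by (simp add: dist_of_linfty_abs distrib_left integrable_schwartz ess_bounded_integrable)
  moreover have "dist_of_linfty f (\<lambda>x. a * \<phi> x) = a * dist_of_linfty f \<phi>" for a \<phi>
    using f0 by (simp add: dist_of_linfty_abs mult.left_commute)
  moreover have "cmod (dist_of_linfty f \<phi>)
      \<le> (norm f * (2 ^ CARD('n) * (\<integral>x. weight (x::real^'n) \<partial>lebesgue))) * schwartz_seminorm (2 * CARD('n)) \<phi>"
    if \<phi>: "\<phi> \<in> schwartz" for \<phi>
  proof -
    have "(\<integral>x. cmod (\<phi> x) \<partial>lebesgue) \<le> (\<integral>x. 2 ^ CARD('n) * schwartz_seminorm (2 * CARD('n)) \<phi> * weight (x :: real^'n) \<partial>lebesgue)"
      by (intro integral_mono integrable_norm integrable_schwartz \<phi> integrable_mult_right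
          integrable_weight schwartz_le_seminorm)
    then have "norm f * (\<integral>x. cmod (\<phi> x) \<partial>lebesgue)
        \<le> norm f * (2 ^ CARD('n) * schwartz_seminorm (2 * CARD('n)) \<phi> * (\<integral>x. weight (x::real^'n) \<partial>lebesgue))"
      by (intro mult_left_mono) auto
    then show ?thesis
      using dist_of_linfty_le[OF integrable_schwartz[OF \<phi>], of f] by (simp add: mult_ac)
  qed
  ultimately show ?thesis
    unfolding tempered_def by (intro CollectI conjI ballI allI exI)
qed

text \<open>The dilation has been moved from \<open>\<eta>\<close> to the test function. The
  function to be transformed then vanishes outside the support of \<open>\<eta>\<close> for every
  \<open>t\<close>, which makes bounds independent of \<open>t\<close> possible.\<close>

definition cutoff_kernel :: "(real^'n \<Rightarrow> real) \<Rightarrow> real \<Rightarrow> (real^'n \<Rightarrow> complex) \<Rightarrow> real^'n \<Rightarrow> complex" where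
  "cutoff_kernel \<eta> t \<phi> = fourier (\<lambda>\<xi>. complex_of_real (\<eta> \<xi>) * \<phi> (inverse t *\<^sub>R \<xi>))"

section \<open>Values and sign of the cutoff\<close>

lemma
  assumes "cutoff \<eta>"
  shows cutoff_smooth: "smooth \<eta>"
    and cutoff_support: "closure {x. \<eta> x \<noteq> 0} \<subseteq> cball 0 2"
    and cutoff_near_0: "\<exists>U. open U \<and> cball 0 1 \<subseteq> U \<and> (\<forall>x\<in>U. \<eta> x = 1)"
    and cutoff_monotone: "\<forall>e. norm e = 1 \<longrightarrow> monotone_on {0..} (\<le>) (\<ge>) (\<lambda>r::real. \<eta> (r *\<^sub>R e))"
  using assms unfolding cutoff_def by - (elim conjE, assumption)+

lemma cutoff_eq_0:
  assumes "cutoff \<eta>" "2 < norm x"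
  shows "\<eta> x = 0"
proof (rule ccontr)
  assume "\<eta> x \<noteq> 0"
  then have "x \<in> closure {x. \<eta> x \<noteq> 0}"
    by (intro subsetD[OF closure_subset]) simp
  then have "x \<in> cball 0 2"
    using cutoff_support[OF assms(1)] by blast
  with assms(2) show False by simp
qed

lemma cutoff_eq_1:
  assumes "cutoff \<eta>" "norm x \<le> 1"
  shows "\<eta> x = 1"
proof -
  have "x \<in> cball 0 1"
    using assms(2) by simp
  then show ?thesis
    using cutoff_near_0[OF assms(1)] by blast
qed

text \<open>On the ray through \<open>x\<close> the cutoff is nonincreasing and vanishes beyond
  radius 2, so it cannot be negative earlier. This later makes the integral of \<open>\<eta>\<close>
  positive.\<close>

lemma cutoff_nonneg:
  fixes \<eta> :: "real^'n \<Rightarrow> real"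
  assumes \<eta>: "cutoff \<eta>"
  shows "0 \<le> \<eta> x"
proof (cases "norm x \<le> 1")
  case True
  then show ?thesis using cutoff_eq_1[OF \<eta>] by simp
next
  case False
  define e where "e = x /\<^sub>R norm x"
  have e: "norm e = 1" "x = norm x *\<^sub>R e"
  proof -
    have "x \<noteq> 0"
      using False by auto
    then show "norm e = 1" "x = norm x *\<^sub>R e"
      unfolding e_def by simp_all
  qed
  have "monotone_on {0..} (\<le>) (\<ge>) (\<lambda>r::real. \<eta> (r *\<^sub>R e))"
    using cutoff_monotone[OF \<eta>, rule_format, OF e(1)] .
  then have "\<eta> ((norm x + 3) *\<^sub>R e) \<le> \<eta> (norm x *\<^sub>R e)"
    by (rule monotone_onD) auto
  moreover have "\<eta> ((norm x + 3) *\<^sub>R e) = 0"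
    using e(1) by (intro cutoff_eq_0[OF \<eta>]) (simp add: add_pos_nonneg)
  ultimately have "0 \<le> \<eta> (norm x *\<^sub>R e)" by linarith
  then show ?thesis by (subst e(2))
qed

section \<open>Cutoff kernels and the change of scale\<close>

lemma
  fixes \<eta> :: "real^'n \<Rightarrow> real"
  assumes \<eta>: "cutoff \<eta>" and \<phi>: "\<phi> \<in> schwartz"
  shows continuous_cutoff_kernel: "continuous_on UNIV (cutoff_kernel \<eta> t \<phi>)"
    and fourier_mult_cutoff: "t > 0 \<Longrightarrow> fourier (\<lambda>\<xi>. complex_of_real (\<eta> (t *\<^sub>R \<xi>)) * \<phi> \<xi>) x
      = inverse t ^ CARD('n) *\<^sub>R cutoff_kernel \<eta> t \<phi> (inverse t *\<^sub>R x)"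
proof -
  let ?g = "\<lambda>\<xi>. complex_of_real (\<eta> \<xi>) * \<phi> (inverse t *\<^sub>R \<xi>)"
  have s\<phi>: "smooth \<phi>"
    using \<phi> by (simp add: schwartz_def)
  have int: "integrable lebesgue ?g"
  proof (rule integrable_lebesgue_compact_support)
    have c: "continuous_on UNIV \<eta>" "continuous_on UNIV \<phi>"
      using smooth_partial_derivs(3)[OF cutoff_smooth[OF \<eta>], of "[]"] smooth_partial_derivs(3)[OF s\<phi>, of "[]"] by simp_all
    show "continuous_on UNIV ?g"
      by (intro continuous_intros c(1) continuous_on_compose2[OF c(2)]) auto
    show "?g x = 0" if "2 < norm x" for x
      using cutoff_eq_0[OF \<eta> that] by simp
  qed
  then show "continuous_on UNIV (cutoff_kernel \<eta> t \<phi>)"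
    unfolding cutoff_kernel_def by (rule continuous_on_fourier)
  show "fourier (\<lambda>\<xi>. complex_of_real (\<eta> (t *\<^sub>R \<xi>)) * \<phi> \<xi>) x
      = inverse t ^ CARD('n) *\<^sub>R cutoff_kernel \<eta> t \<phi> (inverse t *\<^sub>R x)" if t: "t > 0"
  proof -
    \<comment> \<open>Inserting a dilation and its inverse inside \<open>\<phi>\<close> exhibits the
      function to be transformed as \<open>?g\<close> composed with the dilation by
      \<open>t\<close>.\<close>
    have "inverse t *\<^sub>R t *\<^sub>R \<xi> = \<xi>" for \<xi> :: "real^'n"
      using t by simp
    then show ?thesis
      using fourier_scale[OF borel_measurable_integrable[OF int] t, of x]
      unfolding cutoff_kernel_def by (simp only:)
  qed
qed

lemma cutoff_kernel_le_weight:
  fixes \<eta> :: "real^'n \<Rightarrow> real"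
  assumes \<eta>: "cutoff \<eta>" and \<phi>: "\<phi> \<in> schwartz"
  obtains C where "\<And>t y. t \<ge> 1 \<Longrightarrow> cmod (cutoff_kernel \<eta> t \<phi> y) \<le> C * weight y"
proof (rule fourier_cutoff_le_weight[OF cutoff_smooth[OF \<eta>] cutoff_eq_0[OF \<eta>] \<phi>])
  fix C
  assume *: "\<And>t y. t \<ge> 1 \<Longrightarrow> cmod (fourier (\<lambda>\<xi>. complex_of_real (\<eta> \<xi>) * \<phi> (inverse t *\<^sub>R \<xi>)) y) \<le> C * weight y"
  show thesis
    by (rule that[of C]) (rule *[folded cutoff_kernel_def])
qed

lemma integrable_cutoff_kernel:
  assumes \<eta>: "cutoff \<eta>" and \<phi>: "\<phi> \<in> schwartz" and t: "t \<ge> 1"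
  shows "integrable lebesgue (cutoff_kernel \<eta> t \<phi>)"
proof -
  obtain C where C: "\<And>t y. t \<ge> 1 \<Longrightarrow> cmod (cutoff_kernel \<eta> t \<phi> y) \<le> C * weight y"
    using cutoff_kernel_le_weight[OF \<eta> \<phi>] by blast
  show ?thesis
  proof (rule Bochner_Integration.integrable_bound)
    show "integrable lebesgue (\<lambda>y. C * weight y)"
      by (intro integrable_mult_right integrable_weight)
    show "cutoff_kernel \<eta> t \<phi> \<in> borel_measurable lebesgue"
      using continuous_cutoff_kernel[OF \<eta> \<phi>]
      by (intro measurable_completion) (simp add: borel_measurable_continuous_onI)
    show "AE y in lebesgue. norm (cutoff_kernel \<eta> t \<phi> y) \<le> norm (C * weight y)"
      unfolding real_norm_def by (intro AE_I2 order_trans[OF C[OF t] abs_ge_self])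
  qed
qed

text \<open>Substitution x = t y: the Jacobian, t to the power of the dimension, cancels the factor
  in \<open>fourier_mult_cutoff\<close>. The scale is thereby transferred to \<open>f\<close>, and
  the L^1 norm of the test function becomes that of the kernel.\<close>

lemma
  fixes \<eta> :: "real^'n \<Rightarrow> real"
  assumes \<eta>: "cutoff \<eta>" and \<phi>: "\<phi> \<in> schwartz" and t: "t \<ge> 1"
  defines "\<psi> \<equiv> fourier (\<lambda>\<xi>. complex_of_real (\<eta> (t *\<^sub>R \<xi>)) * \<phi> \<xi>)"
  shows integrable_fourier_mult_cutoff: "integrable lebesgue \<psi>"
    and integral_fourier_mult_cutoff: "f \<in> borel_measurable lebesgue \<Longrightarrow>
      (\<integral>x. f x * \<psi> x \<partial>lebesgue) = (\<integral>y. f (t *\<^sub>R y) * cutoff_kernel \<eta> t \<phi> y \<partial>lebesgue)"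
    and integral_norm_fourier_mult_cutoff:
      "(\<integral>x. cmod (\<psi> x) \<partial>lebesgue) = (\<integral>y. cmod (cutoff_kernel \<eta> t \<phi> y) \<partial>lebesgue)"
proof -
  have t0: "t > 0" using t by simp
  have \<psi>: "\<psi> = (\<lambda>x. inverse t ^ CARD('n) *\<^sub>R cutoff_kernel \<eta> t \<phi> (inverse t *\<^sub>R x))"
    unfolding \<psi>_def using fourier_mult_cutoff[OF \<eta> \<phi> t0] by blast
  show int: "integrable lebesgue \<psi>"
    unfolding \<psi> using t0 integrable_lebesgue_scale[OF _ integrable_cutoff_kernel[OF \<eta> \<phi> t], of "inverse t"]
    by (intro integrable_scaleR_right) auto
  have \<psi>t: "t ^ CARD('n) *\<^sub>R \<psi> (t *\<^sub>R y) = cutoff_kernel \<eta> t \<phi> y" for y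
    using t0 by (simp add: \<psi> power_inverse)
  show "(\<integral>x. f x * \<psi> x \<partial>lebesgue) = (\<integral>y. f (t *\<^sub>R y) * cutoff_kernel \<eta> t \<phi> y \<partial>lebesgue)"
    if f: "f \<in> borel_measurable lebesgue"
  proof -
    have "(\<integral>x. f x * \<psi> x \<partial>lebesgue) = t ^ CARD('n) *\<^sub>R (\<integral>y. f (t *\<^sub>R y) * \<psi> (t *\<^sub>R y) \<partial>lebesgue)"
      using integral_lebesgue_scale[of t "\<lambda>x. f x * \<psi> x"] f int t0 by simp
    also have "\<dots> = (\<integral>y. f (t *\<^sub>R y) * (t ^ CARD('n) *\<^sub>R \<psi> (t *\<^sub>R y)) \<partial>lebesgue)"
      by (simp only: scaleR_conv_of_real mult.left_commute integral_mult_right_zero)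
    finally show ?thesis unfolding \<psi>t .
  qed
  have "(\<integral>x. cmod (\<psi> x) \<partial>lebesgue) = t ^ CARD('n) * (\<integral>y. cmod (\<psi> (t *\<^sub>R y)) \<partial>lebesgue)"
    using integral_lebesgue_scale[of t "\<lambda>x. cmod (\<psi> x)"] int t0 by simp
  also have "\<dots> = (\<integral>y. cmod (t ^ CARD('n) *\<^sub>R \<psi> (t *\<^sub>R y)) \<partial>lebesgue)"
    using t0 by (simp only: norm_scaleR abs_of_pos zero_less_power integral_mult_right_zero)
  finally show "(\<integral>x. cmod (\<psi> x) \<partial>lebesgue) = (\<integral>y. cmod (cutoff_kernel \<eta> t \<phi> y) \<partial>lebesgue)"
    unfolding \<psi>t .
qed

section \<open>The bounded elements of S'_h form a closed subspace\<close>

lemma Sh_linfty_iff: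
  "f \<in> Sh_linfty \<eta> \<longleftrightarrow> (\<forall>\<phi>\<in>schwartz.
    ((\<lambda>t. dist_of_linfty f (fourier (\<lambda>\<xi>. complex_of_real (\<eta> (t *\<^sub>R \<xi>)) * \<phi> \<xi>))) \<longlongrightarrow> 0) at_top)"
  by (simp add: Sh_linfty_def Sh_def dist_of_linfty_tempered mult_dist_def fourier_dist_def)

lemma subspace_Sh_linfty:
  assumes \<eta>: "cutoff \<eta>"
  shows "subspace (Sh_linfty \<eta>)"
proof (rule subspaceI)
  let ?\<psi> = "\<lambda>t \<phi>. fourier (\<lambda>\<xi>. complex_of_real (\<eta> (t *\<^sub>R \<xi>)) * \<phi> \<xi>)"
  show "0 \<in> Sh_linfty \<eta>"
    using dist_of_linfty_scaleC[of 0 "0 :: 'a linfty"] by (simp add: Sh_linfty_iff)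
  show "f + g \<in> Sh_linfty \<eta>" if "f \<in> Sh_linfty \<eta>" "g \<in> Sh_linfty \<eta>" for f g
    unfolding Sh_linfty_iff
  proof
    fix \<phi> :: "real^'a \<Rightarrow> complex" assume \<phi>: "\<phi> \<in> schwartz"
    have "((\<lambda>t. dist_of_linfty f (?\<psi> t \<phi>) + dist_of_linfty g (?\<psi> t \<phi>)) \<longlongrightarrow> 0 + 0) at_top"
      using that \<phi> by (intro tendsto_add) (auto simp: Sh_linfty_iff)
    \<comment> \<open>Additivity of the pairing asks for integrable test functions, available for
      \<open>t \<ge> 1\<close>; that is enough for a limit at infinity.\<close>
    moreover have "\<forall>\<^sub>F t in at_top. dist_of_linfty f (?\<psi> t \<phi>) + dist_of_linfty g (?\<psi> t \<phi>)
        = dist_of_linfty (f + g) (?\<psi> t \<phi>)"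
      using eventually_ge_at_top[of 1]
      by eventually_elim (simp add: dist_of_linfty_add integrable_fourier_mult_cutoff[OF \<eta> \<phi>])
    ultimately show "((\<lambda>t. dist_of_linfty (f + g) (?\<psi> t \<phi>)) \<longlongrightarrow> 0) at_top"
      by (simp add: tendsto_cong)
  qed
  show "c *\<^sub>R f \<in> Sh_linfty \<eta>" if "f \<in> Sh_linfty \<eta>" for c f
    using that unfolding scaleC_of_real[symmetric] Sh_linfty_iff dist_of_linfty_scaleC
    by (intro ballI tendsto_mult_right_zero) (drule (1) bspec, assumption)
qed

text \<open>For t >= 1 the L^1 norms of the test functions have a common bound \<open>W\<close>.
  Replacing \<open>f\<close> by a nearby \<open>F n\<close> therefore changes the pairing by at most
  \<open>norm (F n - f) * W\<close> at all these scales, and the limits in \<open>n\<close> and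
  \<open>t\<close> can be exchanged.\<close>

lemma closed_Sh_linfty:
  fixes \<eta> :: "real^'n \<Rightarrow> real"
  assumes \<eta>: "cutoff \<eta>"
  shows "closed (Sh_linfty \<eta>)"
  unfolding closed_sequential_limits
proof (intro allI impI)
  let ?\<psi> = "\<lambda>t \<phi>. fourier (\<lambda>\<xi>. complex_of_real (\<eta> (t *\<^sub>R \<xi>)) * \<phi> \<xi>)"
  fix F and f :: "'n linfty"
  assume "(\<forall>n. F n \<in> Sh_linfty \<eta>) \<and> F \<longlonglongrightarrow> f"
  then have F: "\<And>n. F n \<in> Sh_linfty \<eta>" "F \<longlonglongrightarrow> f" by auto
  show "f \<in> Sh_linfty \<eta>"
    unfolding Sh_linfty_iff
  proof (intro ballI tendstoI)
    fix \<phi> :: "real^'n \<Rightarrow> complex" and e :: real assume \<phi>: "\<phi> \<in> schwartz" and e: "e > 0"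
    obtain C where C: "\<And>t y. t \<ge> 1 \<Longrightarrow> cmod (cutoff_kernel \<eta> t \<phi> y) \<le> C * weight y"
      using cutoff_kernel_le_weight[OF \<eta> \<phi>] by blast
    \<comment> \<open>The absolute value and the added 1 make \<open>W\<close> positive whatever the
      sign of \<open>C\<close>, so that one may divide by it.\<close>
    define W where "W = \<bar>\<integral>y. C * weight (y :: real^'n) \<partial>lebesgue\<bar> + 1"
    have W: "W > 0" by (simp add: W_def add_nonneg_pos)
    have le: "(\<integral>x. cmod (?\<psi> t \<phi> x) \<partial>lebesgue) \<le> W" if t: "t \<ge> 1" for t
    proof -
      have "(\<integral>y. cmod (cutoff_kernel \<eta> t \<phi> y) \<partial>lebesgue) \<le> (\<integral>y. C * weight (y :: real^'n) \<partial>lebesgue)"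
        using C[OF t] integrable_cutoff_kernel[OF \<eta> \<phi> t]
        by (intro integral_mono integrable_norm integrable_mult_right integrable_weight)
      then show ?thesis
        unfolding integral_norm_fourier_mult_cutoff[OF \<eta> \<phi> t] W_def by linarith
    qed
    obtain n where n: "dist (F n) f < e / (2 * W)"
      using metric_LIMSEQ_D[OF F(2), of "e / (2 * W)"] e W by auto
    have "\<forall>\<^sub>F t in at_top. dist (dist_of_linfty (F n) (?\<psi> t \<phi>)) 0 < e / 2"
      using F(1)[of n] \<phi> e by (intro tendstoD) (auto simp: Sh_linfty_iff)
    then show "\<forall>\<^sub>F t in at_top. dist (dist_of_linfty f (?\<psi> t \<phi>)) 0 < e"
      using eventually_ge_at_top[of 1]
    proof eventually_elim
      case (elim t)
      have "dist_of_linfty f (?\<psi> t \<phi>) = dist_of_linfty (F n) (?\<psi> t \<phi>) - dist_of_linfty (F n - f) (?\<psi> t \<phi>)"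
        using integrable_fourier_mult_cutoff[OF \<eta> \<phi>] elim by (simp add: dist_of_linfty_diff)
      moreover have "cmod (dist_of_linfty (F n - f) (?\<psi> t \<phi>)) \<le> norm (F n - f) * W"
        using dist_of_linfty_le[OF integrable_fourier_mult_cutoff[OF \<eta> \<phi>], of t "F n - f"] le[of t] elim
        by (meson mult_left_mono norm_ge_zero order_trans)
      moreover have "norm (F n - f) * W < e / 2"
        using n W by (simp add: dist_norm field_simps)
      ultimately show ?case
        using elim(1) norm_triangle_ineq4[of "dist_of_linfty (F n) (?\<psi> t \<phi>)" "dist_of_linfty (F n - f) (?\<psi> t \<phi>)"]
        by simp
    qed
  qed
qed

section \<open>Quotients and bounded sequences\<close>

lemma uncountable_UNIV_nat_bool: "uncountable (UNIV :: (nat \<Rightarrow> bool) set)"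
proof
  assume "countable (UNIV :: (nat \<Rightarrow> bool) set)"
  then have *: "range (from_nat_into (UNIV :: (nat \<Rightarrow> bool) set)) = UNIV"
    by (intro range_from_nat_into) auto
  have "(\<lambda>n. \<not> from_nat_into (UNIV :: (nat \<Rightarrow> bool) set) n n) \<in> range (from_nat_into UNIV)"
    unfolding * by simp
  then obtain k where "(\<lambda>n. \<not> from_nat_into (UNIV :: (nat \<Rightarrow> bool) set) n n) = from_nat_into UNIV k"
    by (rule rangeE)
  from fun_cong[OF this, of k] show False
    by simp
qed

text \<open>Choosing for every \<open>b\<close> a point of a countable dense set within 1/2 of its
  coset is injective by the separation, which would make the set of all \<open>b\<close>
  countable.\<close>

lemma not_separable_quot:
  fixes X :: "(nat \<Rightarrow> bool) \<Rightarrow> 'a::complex_normed_vector"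
  assumes C: "subspace C" "closed C" and sep: "\<And>b b'. b \<noteq> b' \<Longrightarrow> 1 \<le> infdist (X b - X b') C"
  shows "\<not> separable_space (quot_topology C)"
proof
  interpret Metric_space "quot C" setdist
    by (rule Metric_space_quot[OF C])
  assume "separable_space (quot_topology C)"
  then obtain S where S: "countable S" "S \<subseteq> quot C" "mtopology closure_of S = quot C"
    unfolding separable_space_def quot_topology_def topspace_mtopology by blast
  have q: "X b +o C \<in> quot C" for b
    by (auto simp: quot_def)
  have "\<exists>s. s \<in> S \<and> setdist (X b +o C) s < 1/2" for b
  proof -
    have "X b +o C \<in> mtopology closure_of S"
      unfolding S(3) by (rule q)
    then have "\<forall>r>0. \<exists>y\<in>S. y \<in> mball (X b +o C) r"
      unfolding metric_closure_of by blast
    then obtain y where "y \<in> S" "y \<in> mball (X b +o C) (1/2)"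
      by (elim allE[of _ "1/2"]) auto
    then show ?thesis
      unfolding in_mball by blast
  qed
  then have "\<exists>s. \<forall>b. s b \<in> S \<and> setdist (X b +o C) (s b) < 1/2"
    by (intro choice allI)
  then obtain s where s: "\<And>b. s b \<in> S" "\<And>b. setdist (X b +o C) (s b) < 1/2"
    by blast
  have "inj s"
  proof (rule injI, rule ccontr)
    fix b b' assume eq: "s b = s b'" and ne: "b \<noteq> b'"
    have "setdist (X b +o C) (X b' +o C) \<le> setdist (X b +o C) (s b) + setdist (s b) (X b' +o C)"
      by (intro triangle q subsetD[OF S(2)] s(1))
    also have "\<dots> < 1"
      using s(2)[of b] s(2)[of b'] unfolding eq setdist_sym[of "s b'"] by linarith
    finally show False
      using sep[OF ne] by (simp add: setdist_coset[OF C(1)] quot_norm_coset[OF C(1)])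
  qed
  moreover have "countable (range s)"
    by (rule countable_subset[OF _ S(1)]) (use s(1) in auto)
  ultimately have "countable (UNIV :: (nat \<Rightarrow> bool) set)"
    by (rule countable_image_inj_on[rotated])
  then show False
    using uncountable_UNIV_nat_bool by blast
qed

section \<open>Cosets and induced maps\<close>

lemma subspace_coset_plus:
  assumes "subspace C"
  shows "(x +o C) + (y +o C) = (x + y) +o C"
proof -
  have "C + C = C"
  proof (intro equalityI subsetI)
    fix z assume "z \<in> C"
    then have "0 + z \<in> C + C"
      using subspace_0[OF assms] by (intro set_plus_intro)
    then show "z \<in> C + C" by simp
  qed (auto elim!: set_plus_elim intro: subspace_add[OF assms])
  then show ?thesis
    by (simp add: set_plus_rearrange)
qed

lemma quot_scale_coset:
  assumes C: "subspace C" and scale: "\<And>c. c \<in> C \<Longrightarrow> a *\<^sub>C c \<in> C"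
  shows "quot_scale C a (x +o C) = (a *\<^sub>C x) +o C"
proof (intro equalityI subsetI)
  fix z assume "z \<in> quot_scale C a (x +o C)"
  then obtain c d where cd: "c \<in> C" "d \<in> C" "z = a *\<^sub>C (x + c) + d"
    by (auto simp: quot_scale_def set_plus_def elt_set_plus_def)
  then have "z = a *\<^sub>C x + (a *\<^sub>C c + d)"
    by (simp add: scaleC_add_right add.assoc)
  then show "z \<in> (a *\<^sub>C x) +o C"
    using cd subspace_add[OF C] scale unfolding elt_set_plus_def by blast
next
  fix z assume "z \<in> (a *\<^sub>C x) +o C"
  then obtain d where "d \<in> C" "z = a *\<^sub>C (x + 0) + d"
    by (auto simp: elt_set_plus_def)
  then show "z \<in> quot_scale C a (x +o C)"
    using subspace_0[OF C] unfolding quot_scale_def set_plus_def elt_set_plus_def by blast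
qed

text \<open>The norm of a coset is the distance of a representative to the subspace, so preserved
  distances give the quasi-isometry with K = 1. The algebraic clauses follow because the induced map
  sends the coset of \<open>u\<close> to that of \<open>J u\<close>.\<close>

lemma quot_quasi_isometryI:
  assumes J: "bounded_clinear J" and C: "subspace C" "\<And>a x. x \<in> C \<Longrightarrow> a *\<^sub>C x \<in> C"
    and D: "subspace D" "\<And>a x. x \<in> D \<Longrightarrow> a *\<^sub>C x \<in> D" and JC: "J ` C \<subseteq> D"
    and iso: "\<And>u. infdist (J u) D = infdist u C"
  shows "quot_quasi_isometry C D (induced_map J D)"
proof -
  have T: "induced_map J D (u +o C) = J u +o D" for u
    using J JC subspace_0[OF C(1)] subspace_add[OF D(1)] by (rule induced_map_coset)
  have J_add: "J (u + v) = J u + J v" and J_scale: "J (a *\<^sub>C u) = a *\<^sub>C J u" for u v a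
    using J by (auto simp: bounded_clinear_def linear_simps)
  show ?thesis
    unfolding quot_quasi_isometry_def
  proof (intro conjI ballI allI exI[of _ 1])
    show "induced_map J D ` quot C \<subseteq> quot D"
      by (auto simp: quot_def T)
    fix X assume "X \<in> quot C"
    then obtain u where X: "X = u +o C" by (auto simp: quot_def)
    show "induced_map J D (quot_scale C a X) = quot_scale D a (induced_map J D X)" for a
      by (simp add: X T quot_scale_coset C D J_scale)
    show "inverse 1 * quot_norm X \<le> quot_norm (induced_map J D X)"
      "quot_norm (induced_map J D X) \<le> 1 * quot_norm X"
      by (simp_all add: X T quot_norm_coset C D iso)
    fix Y assume "Y \<in> quot C"
    then obtain v where Y: "Y = v +o C" by (auto simp: quot_def)
    show "induced_map J D (X + Y) = induced_map J D X + induced_map J D Y"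
      by (simp add: X Y T subspace_coset_plus C D J_add)
  qed simp
qed

section \<open>The space c_0 and distances to it\<close>

lemma scaleC_bcontfun_apply: "apply_bcontfun (a *\<^sub>C u) n = a * apply_bcontfun u n"
  by (simp add: scaleC_bcontfun.rep_eq scaleC_complex_def)

lemma scaleC_in_c0: "u \<in> c0 \<Longrightarrow> a *\<^sub>C u \<in> c0"
  by (simp add: c0_def scaleC_bcontfun_apply[abs_def] tendsto_mult_right_zero)

lemma subspace_c0: "subspace c0"
proof (rule subspaceI)
  show "0 \<in> c0"
    by (simp add: c0_def zero_bcontfun.rep_eq)
  show "u + v \<in> c0" if "u \<in> c0" "v \<in> c0" for u v
    using tendsto_add[of "apply_bcontfun u" 0 sequentially "apply_bcontfun v" 0] that
    by (simp add: c0_def plus_bcontfun.rep_eq)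
  show "c *\<^sub>R u \<in> c0" if "u \<in> c0" for c u
    using scaleC_in_c0[OF that, of "complex_of_real c"] by (simp add: scaleC_of_real)
qed

lemma closed_c0: "closed c0"
  unfolding closed_sequential_limits
proof (intro allI impI)
  fix c and u :: "nat \<Rightarrow>\<^sub>C complex"
  assume "(\<forall>n. c n \<in> c0) \<and> c \<longlonglongrightarrow> u"
  then have c: "\<And>n. c n \<in> c0" "c \<longlonglongrightarrow> u" by auto
  show "u \<in> c0"
    unfolding c0_def
  proof (intro CollectI tendstoI)
    fix e :: real assume e: "e > 0"
    obtain k where k: "dist (c k) u < e / 2"
      using metric_LIMSEQ_D[OF c(2), of "e / 2"] e by auto
    have "apply_bcontfun (c k) \<longlonglongrightarrow> 0"
      using c(1)[of k] by (simp add: c0_def)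
    then have "\<forall>\<^sub>F n in sequentially. dist (apply_bcontfun (c k) n) 0 < e / 2"
      using e by (intro tendstoD) auto
    then show "\<forall>\<^sub>F n in sequentially. dist (apply_bcontfun u n) 0 < e"
    proof eventually_elim
      case (elim n)
      have "dist (apply_bcontfun (c k) n) (apply_bcontfun u n) < e / 2"
        using dist_bounded[of "c k" n u] k by linarith
      then show ?case
        using elim dist_triangle2[of "apply_bcontfun u n" 0 "apply_bcontfun (c k) n"]
        by (simp add: dist_commute)
    qed
  qed
qed

text \<open>Subtracting the first \<open>N\<close> terms, a sequence in c_0, leaves only the tail,
  so an eventual bound on \<open>u\<close> controls the distance.\<close>

lemma infdist_c0_le:
  assumes "\<forall>\<^sub>F n in sequentially. cmod (apply_bcontfun u n) \<le> B"
  shows "infdist u c0 \<le> B"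
proof -
  obtain N where N: "\<And>n. n \<ge> N \<Longrightarrow> cmod (apply_bcontfun u n) \<le> B"
    using assms by (auto simp: eventually_sequentially)
  \<comment> \<open>For indices below \<open>N\<close> the difference is 0, so the bound there
    amounts to \<open>0 \<le> B\<close>.\<close>
  have B: "0 \<le> B"
    using N[of N] by (meson norm_ge_zero order.refl order_trans)
  let ?c = "\<lambda>n. if n < N then apply_bcontfun u n else 0"
  have c: "?c \<in> bcontfun"
    by (rule bcontfun_normI[of _ "norm u"]) (auto simp: norm_bounded)
  have "?c \<longlonglongrightarrow> 0"
    by (rule tendsto_eventually) (auto simp: eventually_sequentially intro!: exI[of _ N])
  then have "Bcontfun ?c \<in> c0"
    using c by (simp add: c0_def Bcontfun_inverse)
  then have "infdist u c0 \<le> dist u (Bcontfun ?c)"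
    by (rule infdist_le)
  also have "\<dots> \<le> B"
    using N B by (intro dist_bound) (auto simp: Bcontfun_inverse[OF c])
  finally show ?thesis .
qed

text \<open>Through \<^const>\<open>prod_decode\<close> every bit of \<open>b\<close> is repeated infinitely often, so that
  different \<open>b\<close> stay different modulo \<^const>\<open>c0\<close>.\<close>

definition bit_sequence :: "(nat \<Rightarrow> bool) \<Rightarrow> nat \<Rightarrow>\<^sub>C complex" where
  "bit_sequence b = Bcontfun (\<lambda>n. if b (fst (prod_decode n)) then 1 else 0)"

lemma bit_sequence_apply: "apply_bcontfun (bit_sequence b) n = (if b (fst (prod_decode n)) then 1 else 0)"
proof -
  have "(\<lambda>n. if b (fst (prod_decode n)) then 1 else (0::complex)) \<in> bcontfun"
    by (rule bcontfun_normI[of _ 1]) auto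
  then show ?thesis
    by (simp add: bit_sequence_def Bcontfun_inverse)
qed

text \<open>At the indices \<open>prod_encode (k, m)\<close> carrying a bit \<open>k\<close> where
  \<open>b\<close> and \<open>b'\<close> differ, the difference has modulus 1, while a sequence in
  c_0 tends to 0 along them.\<close>

lemma infdist_bit_sequence:
  assumes "b \<noteq> b'"
  shows "1 \<le> infdist (bit_sequence b - bit_sequence b') c0"
proof -
  have ne: "c0 \<noteq> {}"
    using subspace_0[OF subspace_c0] by blast
  obtain k where k: "b k \<noteq> b' k"
    using assms by blast
  show ?thesis
    unfolding infdist_notempty[OF ne]
  proof (rule cINF_greatest[OF ne])
    fix c assume "c \<in> c0"
    then have c: "apply_bcontfun c \<longlonglongrightarrow> 0"
      by (simp add: c0_def)
    have "filterlim (\<lambda>m. prod_encode (k, m)) sequentially sequentially"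
      by (rule filterlim_at_top_mono[OF filterlim_ident]) (simp add: le_prod_encode_2)
    then have "(\<lambda>m. apply_bcontfun c (prod_encode (k, m))) \<longlonglongrightarrow> 0"
      by (rule filterlim_compose[OF c])
    then have "(\<lambda>m. 1 - cmod (apply_bcontfun c (prod_encode (k, m)))) \<longlonglongrightarrow> 1 - cmod 0"
      by (intro tendsto_intros)
    moreover have "1 - cmod (apply_bcontfun c (prod_encode (k, m))) \<le> dist (bit_sequence b - bit_sequence b') c" for m
    proof -
      let ?n = "prod_encode (k, m)"
      have "dist (apply_bcontfun (bit_sequence b - bit_sequence b') ?n) (apply_bcontfun c ?n)
          \<le> dist (bit_sequence b - bit_sequence b') c"
        by (rule dist_bounded)
      moreover have "cmod (apply_bcontfun (bit_sequence b - bit_sequence b') ?n) = 1"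
        using k by (auto simp: minus_bcontfun.rep_eq bit_sequence_apply)
      ultimately show ?thesis
        using norm_triangle_ineq2[of "apply_bcontfun (bit_sequence b - bit_sequence b') ?n" "apply_bcontfun c ?n"]
        by (simp add: dist_norm)
    qed
    ultimately show "1 \<le> dist (bit_sequence b - bit_sequence b') c"
      by (intro LIMSEQ_le_const2[where X="\<lambda>m. 1 - cmod (apply_bcontfun c (prod_encode (k, m)))"]) auto
  qed
qed

section \<open>The embedding\<close>

text \<open>The shell of index \<open>n\<close> is \<open>exp (n\<^sup>2) \<le> norm x < exp ((n + 1)\<^sup>2)\<close>, apart from the junk values of
  \<^const>\<open>ln\<close> and \<^const>\<open>nat\<close> near the origin. The quotients of \<^term>\<open>exp (real n ^ 2 + real n)\<close> by
  its inner and outer radius tend to infinity and to 0, so seen at that scale the shell fills the whole space.\<close>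

definition shell :: "real^'n \<Rightarrow> nat" where
  "shell x = nat \<lfloor>sqrt (ln (norm x))\<rfloor>"

definition mid_radius :: "nat \<Rightarrow> real" where
  "mid_radius n = exp (real n ^ 2 + real n)"

text \<open>The value 1 at the zeros of \<open>h\<close> keeps the modulus equal to 1 everywhere, so
  \<open>cmod (shell_fun h u x)\<close> is exactly the modulus of a term of
  \<open>u\<close>.\<close>

definition phase :: "(real^'n \<Rightarrow> complex) \<Rightarrow> real^'n \<Rightarrow> complex" where
  "phase h y = (if h y = 0 then 1 else cnj (sgn (h y)))"

definition shell_fun :: "(real^'n \<Rightarrow> complex) \<Rightarrow> (nat \<Rightarrow>\<^sub>C complex) \<Rightarrow> real^'n \<Rightarrow> complex" where
  "shell_fun h u x = apply_bcontfun u (shell x) * phase h (inverse (mid_radius (shell x)) *\<^sub>R x)"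

definition shell_embedding :: "(real^'n \<Rightarrow> complex) \<Rightarrow> (nat \<Rightarrow>\<^sub>C complex) \<Rightarrow> 'n linfty" where
  "shell_embedding h u = abs_linfty (shell_fun h u)"

section \<open>Phases, shells and almost everywhere statements\<close>

lemma mid_radius_pos: "0 < mid_radius n"
  by (simp add: mid_radius_def)

lemma norm_phase: "cmod (phase h y) = 1"
  by (simp add: phase_def norm_sgn)

lemma phase_mult: "phase h y * h y = complex_of_real (cmod (h y))"
proof (cases "h y = 0")
  case False
  then have "cnj (sgn (h y)) * h y = complex_of_real ((cmod (h y))\<^sup>2 / cmod (h y))"
    unfolding of_real_divide complex_norm_square by (simp add: sgn_eq mult.commute)
  with False show ?thesis
    by (simp add: phase_def power2_eq_square)
qed (simp add: phase_def)

lemma norm_shell_fun: "cmod (shell_fun h u x) = cmod (apply_bcontfun u (shell x))"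
  by (simp add: shell_fun_def norm_mult norm_phase)

lemma norm_shell_fun_le: "cmod (shell_fun h u x) \<le> norm u"
  by (simp add: norm_shell_fun norm_bounded)

lemma measurable_shell [measurable]: "shell \<in> borel \<rightarrow>\<^sub>M count_space UNIV"
  unfolding shell_def[abs_def] by measurable

lemma shell_fun_measurable:
  assumes "continuous_on UNIV h"
  shows "shell_fun h u \<in> borel_measurable borel"
proof -
  have [measurable]: "h \<in> borel_measurable borel"
    using assms by (rule borel_measurable_continuous_onI)
  have [measurable]: "cnj \<in> borel_measurable borel"
    by (intro borel_measurable_continuous_onI continuous_intros)
  have [measurable]: "Measurable.pred borel (\<lambda>y. h y = 0)"
    by (auto simp: pred_def intro!: borel_closed closed_Collect_eq assms)
  have [measurable]: "phase h \<in> borel_measurable borel"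
    unfolding phase_def[abs_def] sgn_eq by measurable
  have [measurable]: "mid_radius \<in> count_space UNIV \<rightarrow>\<^sub>M borel" "apply_bcontfun u \<in> count_space UNIV \<rightarrow>\<^sub>M borel"
    by auto
  show ?thesis
    unfolding shell_fun_def[abs_def] by measurable
qed

lemma ess_bounded_shell_fun:
  assumes "continuous_on UNIV h"
  shows "ess_bounded (shell_fun h u)"
  unfolding ess_bounded_def
proof (intro conjI exI AE_I2)
  show "shell_fun h u \<in> borel_measurable lebesgue"
    by (rule measurable_completion) (simp add: shell_fun_measurable[OF assms])
qed (rule norm_shell_fun_le)

lemma shell_eqI:
  assumes "real n ^ 2 \<le> ln (norm x)" "ln (norm x) < (real n + 1) ^ 2"
  shows "shell x = n"
proof -
  have "real n \<le> sqrt (ln (norm x))"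
    using assms(1) by (rule real_le_rsqrt)
  moreover have "sqrt (ln (norm x)) < real n + 1"
    using assms(2) by (intro real_less_lsqrt) auto
  ultimately have "\<lfloor>sqrt (ln (norm x))\<rfloor> = int n"
    by (simp add: floor_eq_iff)
  then show ?thesis by (simp add: shell_def)
qed

text \<open>On the logarithmic scale the shell is the interval from n^2 to n^2 + 2 n + 1 and the
  point sits at n^2 + n + ln (norm y), so it is inside as soon as n is at least the modulus of ln
  (norm y).\<close>

lemma shell_scale_mid_radius:
  assumes "y \<noteq> 0"
  shows "\<forall>\<^sub>F n in sequentially. shell (mid_radius n *\<^sub>R y) = n"
proof -
  obtain N where N: "\<bar>ln (norm y)\<bar> \<le> real N"
    using real_arch_simple by blast
  show ?thesis
    using eventually_ge_at_top[of N]
  proof eventually_elim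
    case (elim n)
    have "ln (norm (mid_radius n *\<^sub>R y)) = real n ^ 2 + real n + ln (norm y)"
      using assms by (simp add: mid_radius_def ln_mult)
    moreover have "- real n \<le> ln (norm y)" "ln (norm y) \<le> real n"
      using N elim by linarith+
    moreover have "(real n + 1) ^ 2 = real n ^ 2 + 2 * real n + 1"
      by (simp add: power2_eq_square algebra_simps)
    ultimately show ?case
      by (intro shell_eqI) linarith+
  qed
qed

lemma filterlim_shell_scale:
  assumes "y \<noteq> 0"
  shows "filterlim (\<lambda>t. shell (t *\<^sub>R y)) sequentially at_top"
  unfolding filterlim_at_top
proof
  fix N :: nat
  show "\<forall>\<^sub>F t in at_top. N \<le> shell (t *\<^sub>R y)"
    \<comment> \<open>From the first threshold on, the point has reached the inner radius of shell
      \<open>N\<close>.\<close>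
    using eventually_ge_at_top[of "exp (real N ^ 2) / norm y"] eventually_gt_at_top[of 0]
  proof eventually_elim
    case (elim t)
    then have "exp (real N ^ 2) \<le> norm (t *\<^sub>R y)"
      using assms by (simp add: field_simps)
    then have "ln (exp (real N ^ 2)) \<le> ln (norm (t *\<^sub>R y))"
      using elim assms by (subst ln_le_cancel_iff) auto
    then have "real N \<le> sqrt (ln (norm (t *\<^sub>R y)))"
      by (intro real_le_rsqrt) (simp only: ln_exp)
    then have "int N \<le> \<lfloor>sqrt (ln (norm (t *\<^sub>R y)))\<rfloor>"
      by (simp add: le_floor_iff)
    then show ?case
      by (simp add: shell_def)
  qed
qed

text \<open>Nonempty open sets are not negligible. This turns almost everywhere statements into
  statements at points, for the injectivity of the embedding and for the L^1 norm of the transformed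
  cutoff.\<close>

lemma AE_lebesgue_open_empty:
  fixes S :: "'a::euclidean_space set"
  assumes ae: "AE x in lebesgue. P x" and S: "open S" and P: "\<And>x. x \<in> S \<Longrightarrow> \<not> P x"
  shows "S = {}"
proof (rule ccontr)
  assume "S \<noteq> {}"
  obtain N where "N \<in> null_sets lebesgue" "{x. \<not> P x} \<subseteq> N"
    using ae by (auto simp: eventually_ae_filter)
  then have "negligible S"
    using P by (intro negligible_subset[of N S]) (auto simp: negligible_iff_null_sets)
  then show False
    using open_not_negligible[OF S \<open>S \<noteq> {}\<close>] by blast
qed

lemma AE_lebesgue_nonzero: "AE y in lebesgue. y \<noteq> (0 :: 'a::euclidean_space)"
  by (intro AE_completion AE_lborel_singleton)

section \<open>The embedding: boundedness, complex linearity, injectivity and the image of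
  c_0\<close>

lemma norm_shell_embedding_le:
  assumes "continuous_on UNIV h"
  shows "norm (shell_embedding h u) \<le> norm u"
  unfolding shell_embedding_def norm_abs_linfty[OF ess_bounded_shell_fun[OF assms]]
  by (intro ess_norm_le ess_bounded_shell_fun assms AE_I2 norm_shell_fun_le)

lemma bounded_clinear_shell_embedding:
  assumes h: "continuous_on UNIV h"
  shows "bounded_clinear (shell_embedding h)"
proof -
  note eb = ess_bounded_shell_fun[OF h]
  have add: "shell_embedding h (u + v) = shell_embedding h u + shell_embedding h v" for u v
  proof -
    have "shell_fun h (u + v) = (\<lambda>x. shell_fun h u x + shell_fun h v x)"
      by (simp add: fun_eq_iff shell_fun_def plus_bcontfun.rep_eq distrib_right)
    then show ?thesis
      by (simp add: shell_embedding_def plus_linfty.abs_eq linfty_rel_refl eb)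
  qed
  have scale: "shell_embedding h (a *\<^sub>C u) = a *\<^sub>C shell_embedding h u" for a u
  proof -
    have "shell_fun h (a *\<^sub>C u) = (\<lambda>x. a * shell_fun h u x)"
      by (simp add: fun_eq_iff shell_fun_def scaleC_bcontfun_apply mult.assoc)
    then show ?thesis
      by (simp add: shell_embedding_def scaleC_linfty.abs_eq linfty_rel_refl eb)
  qed
  have "bounded_linear (shell_embedding h)"
    using add scale[of "complex_of_real _"] norm_shell_embedding_le[OF h]
    by (intro bounded_linear_intro[where K=1]) (simp_all add: scaleC_of_real)
  then show ?thesis
    using scale by (simp add: bounded_clinear_def)
qed

text \<open>Each shell contains a nonempty open set, and on it the image function has constant
  modulus, that of the corresponding term of \<open>u\<close>. Vanishing almost everywhere therefore
  forces every term to be 0.\<close>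

lemma embedding_shell_embedding:
  fixes h :: "real^'n \<Rightarrow> complex"
  assumes h: "continuous_on UNIV h"
  shows "embedding (shell_embedding h)"
proof -
  note bl = bounded_clinear_shell_embedding[OF h]
  then have lin: "linear (shell_embedding h)"
    by (simp add: bounded_clinear_def bounded_linear.linear)
  have "u = 0" if u: "shell_embedding h u = 0" for u
  proof (rule bcontfun_eqI)
    fix n
    have "linfty_rel (shell_fun h u) (\<lambda>_. 0)"
      using u Quotient_rel[OF Quotient_linfty, of "shell_fun h u" "\<lambda>_. 0"]
      unfolding shell_embedding_def zero_linfty_def
      by (simp add: linfty_rel_refl ess_bounded_shell_fun[OF h] ess_bounded_zero)
    then have ae: "AE x in lebesgue. shell_fun h u x = 0"
      by (simp add: linfty_rel_def)
    let ?S = "{x :: real^'n. exp (real n ^ 2) < norm x \<and> norm x < exp ((real n + 1) ^ 2)}"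
    have open_S: "open ?S"
      by (intro open_Collect_conj open_Collect_less continuous_intros)
    obtain e :: "real^'n" where e: "norm e = 1"
      using vector_choose_size[of 1] by auto
    \<comment> \<open>Any exponent strictly between n^2 and (n + 1)^2 would do; the offset 1/2 is
      below 2 n + 1 even for n = 0.\<close>
    have "exp (real n ^ 2 + 1 / 2) *\<^sub>R e \<in> ?S"
      using e by (simp add: power2_eq_square algebra_simps)
    then have "?S \<noteq> {}"
      by blast
    then obtain x where x: "x \<in> ?S" "shell_fun h u x = 0"
      using AE_lebesgue_open_empty[OF ae open_S] by blast
    then have "0 < norm x"
      using less_trans[OF exp_gt_zero] by blast
    then have "real n ^ 2 < ln (norm x)" "ln (norm x) < (real n + 1) ^ 2"
      using x(1) ln_less_cancel_iff[of "exp (real n ^ 2)" "norm x"]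
        ln_less_cancel_iff[of "norm x" "exp ((real n + 1) ^ 2)"] by simp_all
    then have "shell x = n"
      by (intro shell_eqI) auto
    with x(2) show "apply_bcontfun u n = apply_bcontfun 0 n"
      using norm_shell_fun[of h u x] by (simp add: zero_bcontfun.rep_eq)
  qed
  then have "inj (shell_embedding h)"
    using linear_injective_0[OF lin] by blast
  then show ?thesis
    using bl by (simp add: embedding_def)
qed

text \<open>For fixed nonzero \<open>y\<close> the shell index of t y tends to infinity with t, so
  the terms of \<open>u\<close> met there tend to 0. The kernel also changes with \<open>t\<close>,
  but the majorant from \<open>cutoff_kernel_le_weight\<close> serves both this pointwise limit and
  dominated convergence.\<close>

lemma shell_embedding_c0:
  fixes \<eta> :: "real^'n \<Rightarrow> real"
  assumes \<eta>: "cutoff \<eta>" and h: "continuous_on UNIV h" and u: "u \<in> c0"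
  shows "shell_embedding h u \<in> Sh_linfty \<eta>"
  unfolding Sh_linfty_iff
proof
  fix \<phi> :: "real^'n \<Rightarrow> complex" assume \<phi>: "\<phi> \<in> schwartz"
  let ?K = "\<lambda>t. cutoff_kernel \<eta> t \<phi>"
  obtain C where C: "\<And>t y. t \<ge> 1 \<Longrightarrow> cmod (?K t y) \<le> C * weight y"
    using cutoff_kernel_le_weight[OF \<eta> \<phi>] by blast
  have meas: "shell_fun h u \<in> borel_measurable lebesgue"
    using ess_bounded_shell_fun[OF h] by (simp add: ess_bounded_def)
  have u0: "apply_bcontfun u \<longlonglongrightarrow> 0"
    using u by (simp add: c0_def)
  have "((\<lambda>t. \<integral>y. shell_fun h u (t *\<^sub>R y) * ?K t y \<partial>lebesgue) \<longlongrightarrow> integral\<^sup>L lebesgue (\<lambda>_::real^'n. 0)) at_top"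
  proof (rule integral_dominated_convergence_at_top)
    show "integrable lebesgue (\<lambda>y::real^'n. norm u * (C * weight y))"
      by (intro integrable_mult_right integrable_weight)
    show "\<forall>\<^sub>F t in at_top. AE y in lebesgue. norm (shell_fun h u (t *\<^sub>R y) * ?K t y) \<le> norm u * (C * weight y)"
      using eventually_ge_at_top[of 1]
    proof eventually_elim
      case (elim t)
      show ?case
        unfolding norm_mult by (intro AE_I2 mult_mono norm_shell_fun_le C elim) auto
    qed
    show "AE y in lebesgue. ((\<lambda>t. shell_fun h u (t *\<^sub>R y) * ?K t y) \<longlongrightarrow> 0) at_top"
      using AE_lebesgue_nonzero
    proof eventually_elim
      case (elim y)
      have "((\<lambda>t. apply_bcontfun u (shell (t *\<^sub>R y))) \<longlongrightarrow> 0) at_top"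
        by (rule filterlim_compose[OF u0 filterlim_shell_scale[OF elim]])
      then have "((\<lambda>t. cmod (apply_bcontfun u (shell (t *\<^sub>R y))) * (C * weight y)) \<longlongrightarrow> 0) at_top"
        by (intro tendsto_mult_left_zero tendsto_norm_zero)
      then show ?case
      proof (rule Lim_null_comparison[rotated])
        show "\<forall>\<^sub>F t in at_top. norm (shell_fun h u (t *\<^sub>R y) * ?K t y)
            \<le> cmod (apply_bcontfun u (shell (t *\<^sub>R y))) * (C * weight y)"
          using eventually_ge_at_top[of 1]
          by eventually_elim (simp add: norm_mult norm_shell_fun mult_left_mono C)
      qed
    qed
    show "(\<lambda>y. shell_fun h u (t *\<^sub>R y) * ?K t y) \<in> borel_measurable lebesgue" for t
    proof (rule measurable_completion)
      have [measurable]: "shell_fun h u \<in> borel_measurable borel" "?K t \<in> borel_measurable borel"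
        by (auto intro: shell_fun_measurable[OF h] borel_measurable_continuous_onI continuous_cutoff_kernel[OF \<eta> \<phi>])
      show "(\<lambda>y. shell_fun h u (t *\<^sub>R y) * ?K t y) \<in> borel_measurable lborel"
        by measurable
    qed
  qed simp
  moreover have "\<forall>\<^sub>F t in at_top. (\<integral>y. shell_fun h u (t *\<^sub>R y) * ?K t y \<partial>lebesgue)
      = dist_of_linfty (shell_embedding h u) (fourier (\<lambda>\<xi>. complex_of_real (\<eta> (t *\<^sub>R \<xi>)) * \<phi> \<xi>))"
    using eventually_ge_at_top[of 1]
    by eventually_elim (simp add: shell_embedding_def dist_of_linfty_abs[OF ess_bounded_shell_fun[OF h]]
        integral_fourier_mult_cutoff[OF \<eta> \<phi> _ meas])
  ultimately show "((\<lambda>t. dist_of_linfty (shell_embedding h u)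
      (fourier (\<lambda>\<xi>. complex_of_real (\<eta> (t *\<^sub>R \<xi>)) * \<phi> \<xi>))) \<longlongrightarrow> 0) at_top"
    by (simp add: tendsto_cong)
qed

section \<open>The fixed kernel and the lower bound for the distance\<close>

lemma cutoff_kernel_self:
  assumes \<eta>: "cutoff \<eta>" and t: "t \<ge> 2"
  shows "cutoff_kernel \<eta> t (\<lambda>\<xi>. complex_of_real (\<eta> \<xi>)) = fourier (\<lambda>\<xi>. complex_of_real (\<eta> \<xi>))"
proof -
  \<comment> \<open>Where the first factor can be nonzero, norm \<xi> is at most 2 and hence at most
    \<open>t\<close>, so the second factor is 1. With the cutoff as its own test function the kernel
    thus no longer depends on \<open>t\<close>.\<close>
  have "\<eta> \<xi> * \<eta> (inverse t *\<^sub>R \<xi>) = \<eta> \<xi>" for \<xi>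
  proof (cases "2 < norm \<xi>")
    case True
    then show ?thesis using cutoff_eq_0[OF \<eta>] by simp
  next
    case False
    then have "norm (inverse t *\<^sub>R \<xi>) \<le> 1"
      using t by (simp add: field_simps)
    then show ?thesis using cutoff_eq_1[OF \<eta>] by simp
  qed
  then have "(\<lambda>\<xi>. complex_of_real (\<eta> \<xi>) * complex_of_real (\<eta> (inverse t *\<^sub>R \<xi>))) = (\<lambda>\<xi>. complex_of_real (\<eta> \<xi>))"
    by (simp only: of_real_mult[symmetric])
  then show ?thesis
    unfolding cutoff_kernel_def by (rule arg_cong)
qed

lemma cutoff_in_schwartz: "cutoff \<eta> \<Longrightarrow> (\<lambda>\<xi>. complex_of_real (\<eta> \<xi>)) \<in> schwartz"
  by (rule of_real_in_schwartz[OF cutoff_smooth cutoff_eq_0])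

lemma
  fixes \<eta> :: "real^'n \<Rightarrow> real"
  assumes \<eta>: "cutoff \<eta>"
  defines "h \<equiv> fourier (\<lambda>\<xi>. complex_of_real (\<eta> \<xi>))"
  shows continuous_fourier_cutoff: "continuous_on UNIV h"
    and integrable_fourier_cutoff: "integrable lebesgue h"
    and integral_norm_fourier_cutoff_pos: "0 < (\<integral>y. cmod (h y) \<partial>lebesgue)"
proof -
  \<comment> \<open>At scale 2 the function \<open>h\<close> is itself a cutoff kernel, from which
    it inherits continuity and integrability.\<close>
  note K = cutoff_kernel_self[OF \<eta> order.refl, folded h_def]
  note \<phi> = cutoff_in_schwartz[OF \<eta>]
  show cont: "continuous_on UNIV h"
    using continuous_cutoff_kernel[OF \<eta> \<phi>, of 2] unfolding K .
  show int: "integrable lebesgue h"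
    using integrable_cutoff_kernel[OF \<eta> \<phi>, of 2] unfolding K by simp
  have int\<eta>: "integrable lebesgue \<eta>"
    using integrable_Re[OF integrable_schwartz[OF \<phi>]] by simp
  \<comment> \<open>The value of \<open>h\<close> at 0 is the integral of \<open>\<eta>\<close>,
    which is at least the volume of the unit ball, where \<open>\<eta>\<close> is 1.\<close>
  have "measure lebesgue (cball (0::real^'n) 1) = (\<integral>x. indicator (cball (0::real^'n) 1) x \<partial>lebesgue)"
    by simp
  also have "\<dots> \<le> (\<integral>x. \<eta> x \<partial>lebesgue)"
    using int\<eta> cutoff_nonneg[OF \<eta>] cutoff_eq_1[OF \<eta>]
    by (intro integral_mono integrable_real_indicator)
      (auto simp: indicator_def emeasure_bounded_finite[unfolded infinity_ennreal_def])
  finally have "measure lebesgue (cball (0::real^'n) 1) \<le> (\<integral>x. \<eta> x \<partial>lebesgue)" .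
  moreover have "0 < measure lebesgue (cball (0::real^'n) 1)"
    using content_cball_pos[of 1 "0 :: real^'n"] by simp
  ultimately have "0 < (\<integral>x. \<eta> x \<partial>lebesgue)"
    by linarith
  moreover have "h 0 = complex_of_real (\<integral>x. \<eta> x \<partial>lebesgue)"
    by (simp add: h_def fourier_def)
  ultimately have h0: "h 0 \<noteq> 0"
    by simp
  \<comment> \<open>By continuity the nonvanishing at 0 spreads to an open set, which would have to
    be empty if the integral of |h| were 0.\<close>
  have nz: "open {x. h x \<noteq> 0}"
    using cont by (intro open_Collect_neq continuous_intros)
  have "\<not> (AE x in lebesgue. cmod (h x) = 0)"
  proof
    assume "AE x in lebesgue. cmod (h x) = 0"
    then have "{x. h x \<noteq> 0} = {}"
      using nz by (rule AE_lebesgue_open_empty) simp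
    with h0 show False
      by blast
  qed
  then have "(\<integral>y. cmod (h y) \<partial>lebesgue) \<noteq> 0"
    using int by (subst integral_nonneg_eq_0_iff_AE) auto
  then show "0 < (\<integral>y. cmod (h y) \<partial>lebesgue)"
    by (simp add: less_le)
qed

text \<open>The constant \<open>H\<close> occurs twice: as the factor of the \<open>n\<close>-th
  term of \<open>u\<close> in the pairing with the embedded sequence, and as the L^1 norm of
  \<open>\<psi> n\<close> once \<open>mid_radius n\<close> is at least 2. It cancels, which is why
  the factor in front of the norm is 1.\<close>

lemma eventually_le_norm_shell_embedding_diff:
  fixes \<eta> :: "real^'n \<Rightarrow> real"
  assumes \<eta>: "cutoff \<eta>" and g: "g \<in> Sh_linfty \<eta>" and e: "0 < e"
  defines "h \<equiv> fourier (\<lambda>\<xi>. complex_of_real (\<eta> \<xi>))"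
  shows "\<forall>\<^sub>F n in sequentially. cmod (apply_bcontfun u n) \<le> norm (shell_embedding h u - g) + e"
proof -
  define H where "H = (\<integral>y. cmod (h y) \<partial>lebesgue)"
  define \<psi> where "\<psi> n = fourier (\<lambda>\<xi>. complex_of_real (\<eta> (mid_radius n *\<^sub>R \<xi>)) * complex_of_real (\<eta> \<xi>))" for n
  note cont = continuous_fourier_cutoff[OF \<eta>, folded h_def]
  note int = integrable_fourier_cutoff[OF \<eta>, folded h_def]
  note \<phi> = cutoff_in_schwartz[OF \<eta>]
  have H: "0 < H"
    unfolding H_def using integral_norm_fourier_cutoff_pos[OF \<eta>, folded h_def] .
  have meas: "shell_fun h u \<in> borel_measurable lebesgue"
    using ess_bounded_shell_fun[OF cont] by (simp add: ess_bounded_def)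
  have mid: "filterlim mid_radius at_top sequentially"
  proof (rule filterlim_at_top_mono[OF filterlim_real_sequentially always_eventually])
    have "1 + (real n ^ 2 + real n) \<le> mid_radius n" for n
      unfolding mid_radius_def by (rule exp_ge_add_one_self)
    then show "\<forall>n. real n \<le> mid_radius n"
      by (smt (verit) zero_le_power2)
  qed
  have large: "\<forall>\<^sub>F n in sequentially. 2 \<le> mid_radius n"
    using mid by (simp add: filterlim_at_top)
  \<comment> \<open>As \<open>u\<close> need not converge, the expected main term is subtracted
    under the integral and only the difference is shown to tend to 0.\<close>
  have "(\<lambda>n. \<integral>y. shell_fun h u (mid_radius n *\<^sub>R y) * h y - apply_bcontfun u n * complex_of_real (cmod (h y)) \<partial>lebesgue)
      \<longlonglongrightarrow> integral\<^sup>L lebesgue (\<lambda>_::real^'n. 0)"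
  proof (rule integral_dominated_convergence)
    show "integrable lebesgue (\<lambda>y. 2 * norm u * cmod (h y))"
      using int by simp
    show "AE y in lebesgue. norm (shell_fun h u (mid_radius n *\<^sub>R y) * h y - apply_bcontfun u n * complex_of_real (cmod (h y)))
        \<le> 2 * norm u * cmod (h y)" for n
    proof (rule AE_I2)
      fix y
      have "norm (shell_fun h u (mid_radius n *\<^sub>R y) * h y - apply_bcontfun u n * complex_of_real (cmod (h y)))
          \<le> norm u * cmod (h y) + norm u * cmod (h y)"
        by (intro order_trans[OF norm_triangle_ineq4] add_mono)
          (simp_all add: norm_mult mult_right_mono norm_shell_fun_le norm_bounded)
      then show "norm (shell_fun h u (mid_radius n *\<^sub>R y) * h y - apply_bcontfun u n * complex_of_real (cmod (h y)))
        \<le> 2 * norm u * cmod (h y)" by simp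
    qed
    show "AE y in lebesgue. (\<lambda>n. shell_fun h u (mid_radius n *\<^sub>R y) * h y - apply_bcontfun u n * complex_of_real (cmod (h y))) \<longlonglongrightarrow> 0"
      using AE_lebesgue_nonzero
    proof eventually_elim
      case (elim y)
      show ?case
      proof (rule tendsto_eventually)
        show "\<forall>\<^sub>F n in sequentially. shell_fun h u (mid_radius n *\<^sub>R y) * h y - apply_bcontfun u n * complex_of_real (cmod (h y)) = 0"
          using shell_scale_mid_radius[OF elim]
        proof eventually_elim
          case (elim n)
          \<comment> \<open>Once the dilated point lies in shell \<open>n\<close>, the dilation
            inside the phase is undone, and \<open>phase h y * h y\<close> is the modulus of
            \<open>h y\<close>. The integrand is then exactly 0.\<close>
          have "inverse (mid_radius n) *\<^sub>R mid_radius n *\<^sub>R y = y"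
            using mid_radius_pos[of n] by simp
          then have "shell_fun h u (mid_radius n *\<^sub>R y) = apply_bcontfun u n * phase h y"
            unfolding shell_fun_def elim by (simp only:)
          then show ?case
            by (simp add: mult.assoc phase_mult)
        qed
      qed
    qed
    show "(\<lambda>y. shell_fun h u (mid_radius n *\<^sub>R y) * h y - apply_bcontfun u n * complex_of_real (cmod (h y))) \<in> borel_measurable lebesgue" for n
    proof (rule measurable_completion)
      have [measurable]: "shell_fun h u \<in> borel_measurable borel" "h \<in> borel_measurable borel"
        by (auto intro: shell_fun_measurable[OF cont] borel_measurable_continuous_onI[OF cont])
      show "(\<lambda>y. shell_fun h u (mid_radius n *\<^sub>R y) * h y - apply_bcontfun u n * complex_of_real (cmod (h y))) \<in> borel_measurable lborel"
        by measurable
    qed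
  qed simp
  moreover have "(\<integral>y. shell_fun h u (mid_radius n *\<^sub>R y) * h y - apply_bcontfun u n * complex_of_real (cmod (h y)) \<partial>lebesgue)
      = dist_of_linfty (shell_embedding h u) (\<psi> n) - apply_bcontfun u n * complex_of_real H" if n: "2 \<le> mid_radius n" for n
  proof -
    have "integrable lebesgue (\<lambda>y. shell_fun h u (mid_radius n *\<^sub>R y) * h y)"
    proof (rule Bochner_Integration.integrable_bound)
      show "integrable lebesgue (\<lambda>y. norm u * cmod (h y))"
        using int by simp
      have [measurable]: "shell_fun h u \<in> borel_measurable borel" "h \<in> borel_measurable borel"
        by (auto intro: shell_fun_measurable[OF cont] borel_measurable_continuous_onI[OF cont])
      show "(\<lambda>y. shell_fun h u (mid_radius n *\<^sub>R y) * h y) \<in> borel_measurable lebesgue"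
        by (rule measurable_completion) measurable
      show "AE y in lebesgue. norm (shell_fun h u (mid_radius n *\<^sub>R y) * h y) \<le> norm (norm u * cmod (h y))"
        by (simp add: norm_mult mult_right_mono norm_shell_fun_le)
    qed
    moreover have "dist_of_linfty (shell_embedding h u) (\<psi> n) = (\<integral>y. shell_fun h u (mid_radius n *\<^sub>R y) * h y \<partial>lebesgue)"
      unfolding shell_embedding_def dist_of_linfty_abs[OF ess_bounded_shell_fun[OF cont]] \<psi>_def
      using n by (subst integral_fourier_mult_cutoff[OF \<eta> \<phi> _ meas]) (simp_all add: cutoff_kernel_self[OF \<eta>] h_def)
    ultimately show ?thesis
      using int by (simp add: H_def)
  qed
  ultimately have lim1: "(\<lambda>n. dist_of_linfty (shell_embedding h u) (\<psi> n) - apply_bcontfun u n * complex_of_real H) \<longlonglongrightarrow> 0"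
    using large by (subst tendsto_cong) (auto elim: eventually_mono)
  have lim2: "(\<lambda>n. dist_of_linfty g (\<psi> n)) \<longlonglongrightarrow> 0"
    unfolding \<psi>_def using g \<phi> by (intro filterlim_compose[OF _ mid]) (auto simp: Sh_linfty_iff)
  have "(\<lambda>n. dist_of_linfty (shell_embedding h u) (\<psi> n) - apply_bcontfun u n * complex_of_real H - dist_of_linfty g (\<psi> n)) \<longlonglongrightarrow> 0"
    using tendsto_diff[OF lim1 lim2] by simp
  \<comment> \<open>The tolerance \<open>e * H\<close> leaves \<open>e\<close> after the final
    division by \<open>H\<close>.\<close>
  then have "\<forall>\<^sub>F n in sequentially.
      dist (dist_of_linfty (shell_embedding h u) (\<psi> n) - apply_bcontfun u n * complex_of_real H - dist_of_linfty g (\<psi> n)) 0 < e * H"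
    using e H by (intro tendstoD) auto
  then show ?thesis
    using large
  proof eventually_elim
    case (elim n)
    let ?D = "dist_of_linfty (shell_embedding h u - g) (\<psi> n)"
    have t: "1 \<le> mid_radius n"
      using elim by simp
    have int\<psi>: "integrable lebesgue (\<psi> n)"
      unfolding \<psi>_def by (rule integrable_fourier_mult_cutoff[OF \<eta> \<phi> t])
    have "(\<integral>x. cmod (\<psi> n x) \<partial>lebesgue) = H"
      unfolding \<psi>_def integral_norm_fourier_mult_cutoff[OF \<eta> \<phi> t] H_def cutoff_kernel_self[OF \<eta> elim(2)] h_def ..
    then have D: "cmod ?D \<le> norm (shell_embedding h u - g) * H"
      using dist_of_linfty_le[OF int\<psi>, of "shell_embedding h u - g"] by simp
    have "cmod (?D - apply_bcontfun u n * complex_of_real H) < e * H"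
      using elim(1) by (simp add: dist_of_linfty_diff[OF int\<psi>] algebra_simps)
    then have "cmod (apply_bcontfun u n * complex_of_real H) \<le> cmod ?D + e * H"
      using norm_triangle_ineq2[of "apply_bcontfun u n * complex_of_real H" ?D] by (simp add: norm_minus_commute)
    then have "cmod (apply_bcontfun u n) * H \<le> (norm (shell_embedding h u - g) + e) * H"
      using D H by (simp add: norm_mult distrib_right)
    then show ?case
      using H by simp
  qed
qed

text \<open>For the upper bound, the embedding maps c_0 into S'_h and does not increase norms. For
  the lower bound, the distance to any \<open>g\<close>, enlarged by \<open>e\<close>, eventually
  bounds the terms of \<open>u\<close>, and by \<open>infdist_c0_le\<close> an eventual bound
  suffices.\<close>

lemma infdist_shell_embedding:
  fixes \<eta> :: "real^'n \<Rightarrow> real"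
  assumes \<eta>: "cutoff \<eta>"
  defines "h \<equiv> fourier (\<lambda>\<xi>. complex_of_real (\<eta> \<xi>))"
  shows "infdist (shell_embedding h u) (Sh_linfty \<eta>) = infdist u c0"
proof (rule antisym)
  note cont = continuous_fourier_cutoff[OF \<eta>, folded h_def]
  have ne: "c0 \<noteq> {}" "Sh_linfty \<eta> \<noteq> {}"
    using subspace_0[OF subspace_c0] subspace_0[OF subspace_Sh_linfty[OF \<eta>]] by blast+
  show "infdist (shell_embedding h u) (Sh_linfty \<eta>) \<le> infdist u c0"
    unfolding infdist_notempty[OF ne(1)]
  proof (rule cINF_greatest[OF ne(1)])
    fix c assume "c \<in> c0"
    then have "infdist (shell_embedding h u) (Sh_linfty \<eta>) \<le> dist (shell_embedding h u) (shell_embedding h c)"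
      by (intro infdist_le shell_embedding_c0 \<eta> cont)
    also have "\<dots> = norm (shell_embedding h (u - c))"
      using bounded_clinear_shell_embedding[OF cont]
      by (simp add: dist_norm bounded_clinear_def linear_simps)
    also have "\<dots> \<le> dist u c"
      unfolding dist_norm by (rule norm_shell_embedding_le[OF cont])
    finally show "infdist (shell_embedding h u) (Sh_linfty \<eta>) \<le> dist u c" .
  qed
  show "infdist u c0 \<le> infdist (shell_embedding h u) (Sh_linfty \<eta>)"
    unfolding infdist_notempty[OF ne(2)]
  proof (rule cINF_greatest[OF ne(2)])
    fix g assume g: "g \<in> Sh_linfty \<eta>"
    show "infdist u c0 \<le> dist (shell_embedding h u) g"
    proof (rule field_le_epsilon)
      fix e :: real assume "0 < e"
      then show "infdist u c0 \<le> dist (shell_embedding h u) g + e"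
        unfolding h_def dist_norm
        by (intro infdist_c0_le eventually_le_norm_shell_embedding_diff \<eta> g)
    qed
  qed
qed

theorem theorem20:
  fixes \<eta> :: "real^'n \<Rightarrow> real"
  assumes "cutoff \<eta>"
  shows "\<not> separable_space (quot_topology (Sh_linfty \<eta>)) \<and>
    \<not> separable_space (quot_topology c0) \<and>
    (\<exists>J :: (nat \<Rightarrow>\<^sub>C complex) \<Rightarrow> 'n linfty.
       embedding J \<and>
       J ` c0 \<subseteq> Sh_linfty \<eta> \<and>
       quot_quasi_isometry c0 (Sh_linfty \<eta>) (induced_map J (Sh_linfty \<eta>)))"
proof -
  define J :: "(nat \<Rightarrow>\<^sub>C complex) \<Rightarrow> 'n linfty" where
    "J = shell_embedding (fourier (\<lambda>\<xi>. complex_of_real (\<eta> \<xi>)))"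
  note cont = continuous_fourier_cutoff[OF assms]
  have emb: "embedding J" and bl: "bounded_clinear J"
    unfolding J_def by (intro embedding_shell_embedding bounded_clinear_shell_embedding cont)+
  have c0: "J ` c0 \<subseteq> Sh_linfty \<eta>"
    unfolding J_def using shell_embedding_c0[OF assms cont] by blast
  have iso: "infdist (J u) (Sh_linfty \<eta>) = infdist u c0" for u
    unfolding J_def by (rule infdist_shell_embedding[OF assms])
  \<comment> \<open>\<open>subspace\<close> concerns real scalars; a complex linear induced map also
    requires stability under complex ones.\<close>
  have "a *\<^sub>C f \<in> Sh_linfty \<eta>" if "f \<in> Sh_linfty \<eta>" for a f
    using that unfolding Sh_linfty_iff dist_of_linfty_scaleC
    by (intro ballI tendsto_mult_right_zero) (drule (1) bspec, assumption)
  then have "quot_quasi_isometry c0 (Sh_linfty \<eta>) (induced_map J (Sh_linfty \<eta>))"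
    by (intro quot_quasi_isometryI bl subspace_c0 scaleC_in_c0 subspace_Sh_linfty assms c0 iso)
  \<comment> \<open>Since \<open>J\<close> preserves distances modulo the two subspaces, the classes
    of the embedded bit sequences are still separated by 1.\<close>
  moreover have "\<not> separable_space (quot_topology (Sh_linfty \<eta>))"
  proof (rule not_separable_quot[OF subspace_Sh_linfty[OF assms] closed_Sh_linfty[OF assms]])
    fix b b' :: "nat \<Rightarrow> bool" assume "b \<noteq> b'"
    moreover have "J (bit_sequence b - bit_sequence b') = J (bit_sequence b) - J (bit_sequence b')"
      using bl by (simp add: bounded_clinear_def linear_simps)
    ultimately show "1 \<le> infdist (J (bit_sequence b) - J (bit_sequence b')) (Sh_linfty \<eta>)"
      using infdist_bit_sequence iso by metis
  qed
  moreover have "\<not> separable_space (quot_topology c0)"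
    by (rule not_separable_quot[OF subspace_c0 closed_c0 infdist_bit_sequence])
  ultimately show ?thesis
    using emb c0 by blast
qed

end
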